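(* Let $v_1(t),\dots,v_n(t)$ be $n$ arbitrary real analytic functions defined in a neighbourhood of zero. Consider the function $$r(\lambda,t)=\lambda^n-v_1(t)\lambda^{n-1}-v_2(t)\lambda^{n-2}-\dots-v_{n-1}(t)\lambda-v_n(t)$$ and the matrix relation $$r(L,M)=0,\qquad M=x^1L^{n-1}+x^2L^{n-2}+\dots+x^{n-1}L+x^n\,\mathrm{Id},$$ where $L$ is a $\mathrm{gl}$-regular $n\times n$ matrix with characteristic polynomial $\det(\lambda\,\mathrm{Id}-L)=\lambda^n-f_1\lambda^{n-1}-\dots-f_n$. Then: (1) From this matrix relation, the coefficients $f_1,\dots,f_n$ of the characteristic polynomial of $L$ can be uniquely expressed in a neighbourhood of $x=0$ as real analytic functions $f_i=f_i(x)$ of $x=(x^1,\dots,x^n)$ (by the Implicit Function Theorem). (2) The functions $f_1(x),\dots,f_n(x)$ so obtained satisfy the system of PDEs $$\frac{\partial f_i}{\partial x^j}=f_i\frac{\partial f_1}{\partial x^{j+1}}+\frac{\partial f_{i+1}}{\partial x^{j+1}},\qquad \frac{\partial f_n}{\partial x^j}=f_n\frac{\partial f_1}{\partial x^{j+1}},\qquad 1\le i,j\le n-1,$$ together with the initial condition $$f_i(0,\dots,0,x^n)=v_i(x^n),\qquad i=1,\dots,n .$$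
   Context: A real $n\times n$ matrix $L$ is $\mathrm{gl}$-regular if $\mathrm{Id},L,\dots,L^{n-1}$ are linearly independent (equivalently, its minimal and characteristic polynomials coincide). Such a matrix is determined up to similarity by its characteristic polynomial. The expression $r(L,M)$ means $L^n-v_1(M)L^{n-1}-\dots-v_{n-1}(M)L-v_n(M)$, where $v_i(M)$ is the analytic matrix function of $M$ (power series at $0$; for $x$ near $0$ the matrix $M$ has small spectrum). The relation $r(L,M)=0$ is invariant under simultaneous conjugation, hence is a condition on $x$ and on the coefficients $f_1,\dots,f_n$ only; e.g. $L$ may be taken to be the companion matrix with first column $(f_1,\dots,f_n)^\top$, ones on the superdiagonal and zeros elsewhere. *)

theory Defs
  imports "HOL-Analysis.Analysis" "HOL-Analysis.FPS_Convergence"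
begin

text \<open>
  The dimension is \<open>n = CARD('n)\<close>. Since the index type carries no order, an enumeration
  \<open>e :: nat \<Rightarrow> 'n\<close>, bijective from \<open>{1..n}\<close> to \<open>UNIV\<close>, says which
  component is which: the \<open>j\<close>-th coordinate of \<open>x\<close> is \<open>x $ e j\<close>.
\<close>

text \<open>Powers with respect to the matrix product; \<open>A ^ k\<close> on \<open>real ^ 'n ^ 'n\<close> would be
  the entrywise power.\<close>

primrec matpow :: "real ^ 'n ^ 'n \<Rightarrow> nat \<Rightarrow> real ^ 'n ^ 'n" where
  "matpow A 0 = mat 1"
| "matpow A (Suc k) = A ** matpow A k"

text \<open>Injectivity makes this linear independence of the family \<open>Id, L, \<dots>, L\<^sup>n\<^sup>-\<^sup>1\<close>,
  not merely of its set of values.\<close>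

definition gl_regular :: "real ^ 'n ^ 'n \<Rightarrow> bool" where
  "gl_regular L \<longleftrightarrow>
     inj_on (matpow L) {..<CARD('n)} \<and> independent (matpow L ` {..<CARD('n)})"

definition has_char_coeffs :: "(nat \<Rightarrow> 'n) \<Rightarrow> real ^ 'n ^ 'n \<Rightarrow> real ^ 'n \<Rightarrow> bool" where
  "has_char_coeffs e L c \<longleftrightarrow>
     (\<forall>l. det (mat l - L) = l ^ CARD('n) - (\<Sum>i = 1..CARD('n). (c $ e i) * l ^ (CARD('n) - i)))"

definition mat_M :: "(nat \<Rightarrow> 'n) \<Rightarrow> real ^ 'n \<Rightarrow> real ^ 'n ^ 'n \<Rightarrow> real ^ 'n ^ 'n" where
  "mat_M e x L = (\<Sum>j = 1..CARD('n). (x $ e j) *\<^sub>R matpow L (CARD('n) - j))"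

definition mat_fps_convergent :: "real fps \<Rightarrow> real ^ 'n ^ 'n \<Rightarrow> bool" where
  "mat_fps_convergent F A \<longleftrightarrow> summable (\<lambda>k. fps_nth F k *\<^sub>R matpow A k)"

definition mat_fps :: "real fps \<Rightarrow> real ^ 'n ^ 'n \<Rightarrow> real ^ 'n ^ 'n" where
  "mat_fps F A = (\<Sum>k. fps_nth F k *\<^sub>R matpow A k)"

definition mat_r :: "(nat \<Rightarrow> real fps) \<Rightarrow> real ^ 'n ^ 'n \<Rightarrow> real ^ 'n ^ 'n \<Rightarrow> real ^ 'n ^ 'n" where
  "mat_r V L M =
     matpow L CARD('n) - (\<Sum>i = 1..CARD('n). mat_fps (V i) M ** matpow L (CARD('n) - i))"

text \<open>The relation \<open>r(L, M) = 0\<close>, including that the matrix functions \<open>v\<^sub>i(M)\<close> are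
  defined (\<open>suminf\<close> is a junk value for a divergent series).\<close>

definition matrix_relation ::
    "(nat \<Rightarrow> 'n) \<Rightarrow> (nat \<Rightarrow> real fps) \<Rightarrow> real ^ 'n \<Rightarrow> real ^ 'n ^ 'n \<Rightarrow> bool" where
  "matrix_relation e V x L \<longleftrightarrow>
     (\<forall>i\<in>{1..CARD('n)}. mat_fps_convergent (V i) (mat_M e x L)) \<and>
     mat_r V L (mat_M e x L) = 0"

text \<open>Real analyticity in several variables: local expansion in an (unconditionally) convergent
  power series, indexed by multi-indices \<open>\<alpha> :: 'n \<Rightarrow> nat\<close>.\<close>

definition real_analytic_on :: "(real ^ 'n \<Rightarrow> real) \<Rightarrow> (real ^ 'n) set \<Rightarrow> bool" where
  "real_analytic_on g U \<longleftrightarrow> open U \<and>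
     (\<forall>a\<in>U. \<exists>r>0. \<exists>c :: ('n \<Rightarrow> nat) \<Rightarrow> real. \<forall>y\<in>ball a r.
        ((\<lambda>\<alpha>. c \<alpha> * (\<Prod>k\<in>UNIV. (y $ k - a $ k) ^ \<alpha> k)) has_sum g y) UNIV)"

definition partial_deriv :: "'n \<Rightarrow> (real ^ 'n \<Rightarrow> real) \<Rightarrow> real ^ 'n \<Rightarrow> real" where
  "partial_deriv k g x = deriv (\<lambda>t. g (x + t *\<^sub>R axis k 1)) 0"

end

theory Submission
  imports Defs
begin

text \<open>
  Put \<open>m\<^sub>x(X) = x\<^sup>1 X\<^sup>n\<^sup>-\<^sup>1 + \<dots> + x\<^sup>n\<close> and \<open>w\<^sub>x = \<Sum>\<^sub>i X\<^sup>n\<^sup>-\<^sup>i v\<^sub>i(m\<^sub>x)\<close>, so that the relation says that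
  \<open>r\<^sub>x = X\<^sup>n - w\<^sub>x\<close> annihilates \<open>L\<close>. For \<open>L\<close> regular with characteristic polynomial \<open>p\<close> this
  means that \<open>p\<close> divides \<open>r\<^sub>x\<close> in the algebra of power series with finite norm
  \<open>\<Sum>\<^sub>k |F\<^sub>k| K\<^sup>k\<close>. If \<open>K\<close> is large and \<open>x\<close> small, then \<open>w\<^sub>x\<close> has norm at most \<open>K\<^sup>n/3\<close>, and the
  Weierstrass preparation theorem yields exactly one such \<open>p\<close>, namely \<open>p\<^sub>x = q\<^sub>x r\<^sub>x\<close> with a
  unit \<open>q\<^sub>x\<close>. Its coefficients are given by explicit convergent series in \<open>x\<close>, hence are analytic;
  no implicit function theorem is needed. Since \<open>\<partial>\<^sub>j r\<^sub>x = X \<partial>\<^sub>j\<^sub>+\<^sub>1 r\<^sub>x\<close>, the series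
  \<open>\<partial>\<^sub>j p\<^sub>x - X \<partial>\<^sub>j\<^sub>+\<^sub>1 p\<^sub>x\<close> is a multiple of \<open>r\<^sub>x\<close>, hence of \<open>p\<^sub>x\<close>; being of degree at most \<open>n\<close>
  it is a constant multiple, and comparing coefficients gives the PDEs.
\<close>

section \<open>A weighted norm on formal power series\<close>

text \<open>The obstacle is that \<open>L\<close> need not be small: at \<open>x = 0\<close> its
  characteristic coefficients are the arbitrary numbers v_i(0). Only \<open>M\<close> is small, and
  only while \<open>L\<close> stays bounded. The weight \<open>K\<close> quantifies this: it is so
  large that v_1(0) X^(n-1) + ... + v_n(0) has norm below K^n/3, a bound that survives for small
  \<open>x\<close>. Large solutions do occur. For n = 2, v_1 = 0, v_2(t) = t^3 the function r_x is a
  cubic in X whose third root has size about (x^1)^(-3), and a regular \<open>L\<close> may have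
  that root as an eigenvalue. Hence uniqueness is stated inside a set \<open>W\<close> of
  coefficient vectors, and separately for analytic germs, whose value at 0 is forced because there M
  = 0. The three fractions belong together: 1/3 for w_x gives 1/2 for 1 - q_x and for X^n - p_x
  relative to K^n. \<open>W\<close> is cut out by 2/3, which leaves room around the solutions and is
  still below 1, as division by p requires.\<close>

text \<open>The norm \<open>\<Sum>\<^sub>k |F\<^sub>k| K\<^sup>k\<close> is at most \<open>B\<close>; bounding partial sums avoids a summability
  side condition.\<close>

definition fps_norm_le :: "real \<Rightarrow> real fps \<Rightarrow> real \<Rightarrow> bool" where
  "fps_norm_le K F B \<longleftrightarrow> (\<forall>N. (\<Sum>k<N. \<bar>fps_nth F k\<bar> * K ^ k) \<le> B)"

lemma fps_norm_leD: "fps_norm_le K F B \<Longrightarrow> (\<Sum>k<N. \<bar>fps_nth F k\<bar> * K ^ k) \<le> B"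
  by (simp add: fps_norm_le_def)

lemma fps_norm_le_nonneg: "fps_norm_le K F B \<Longrightarrow> 0 \<le> B"
  using fps_norm_leD[of K F B 0] by simp

lemma fps_norm_le_mono: "fps_norm_le K F B \<Longrightarrow> B \<le> C \<Longrightarrow> fps_norm_le K F C"
  unfolding fps_norm_le_def by (meson order_trans)

lemma fps_norm_le_nth:
  assumes "fps_norm_le K F B" "K > 0"
  shows "\<bar>fps_nth F k\<bar> \<le> B / K ^ k"
proof -
  have "\<bar>fps_nth F k\<bar> * K ^ k \<le> (\<Sum>k<Suc k. \<bar>fps_nth F k\<bar> * K ^ k)"
    using assms by (intro member_le_sum) auto
  also have "\<dots> \<le> B" by (rule fps_norm_leD[OF assms(1)])
  finally show ?thesis using assms by (simp add: field_simps)
qed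

lemma fps_norm_le_summable:
  assumes "fps_norm_le K F B" "K > 0"
  shows "summable (\<lambda>k. \<bar>fps_nth F k\<bar> * K ^ k)"
  using assms by (intro bounded_imp_summable[where B = B])
    (auto simp: fps_norm_le_def simp del: sum.lessThan_Suc simp flip: lessThan_Suc_atMost)

lemma fps_norm_le_iff_suminf:
  assumes "K > 0"
  shows "fps_norm_le K F B \<longleftrightarrow>
    summable (\<lambda>k. \<bar>fps_nth F k\<bar> * K ^ k) \<and> (\<Sum>k. \<bar>fps_nth F k\<bar> * K ^ k) \<le> B"
    (is "?l \<longleftrightarrow> ?r")
proof
  assume l: ?l
  from fps_norm_le_summable[OF this assms] show ?r
    by (auto intro!: suminf_le_const simp: fps_norm_leD[OF l])
next
  assume ?r
  then show ?l unfolding fps_norm_le_def using assms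
    by (auto intro!: order_trans[OF sum_le_suminf])
qed

lemma fps_norm_le_0: "0 \<le> B \<Longrightarrow> fps_norm_le K 0 B"
  by (simp add: fps_norm_le_def)

lemma fps_norm_le_add:
  assumes "fps_norm_le K F B" "fps_norm_le K G C" "K > 0"
  shows "fps_norm_le K (F + G) (B + C)"
  unfolding fps_norm_le_def
proof
  fix N
  have "(\<Sum>k<N. \<bar>fps_nth (F + G) k\<bar> * K ^ k)
      \<le> (\<Sum>k<N. \<bar>fps_nth F k\<bar> * K ^ k + \<bar>fps_nth G k\<bar> * K ^ k)"
    using assms by (intro sum_mono) (simp flip: distrib_right add: mult_right_mono)
  also have "\<dots> \<le> B + C"
    using fps_norm_leD[OF assms(1)] fps_norm_leD[OF assms(2)] by (simp add: sum.distrib add_mono)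
  finally show "(\<Sum>k<N. \<bar>fps_nth (F + G) k\<bar> * K ^ k) \<le> B + C" .
qed

lemma fps_norm_le_uminus [simp]: "fps_norm_le K (- F) B \<longleftrightarrow> fps_norm_le K F B"
  by (simp add: fps_norm_le_def)

lemma fps_norm_le_diff:
  assumes "fps_norm_le K F B" "fps_norm_le K G C" "K > 0"
  shows "fps_norm_le K (F - G) (B + C)"
  using fps_norm_le_add[of K F B "- G" C] assms by simp

lemma fps_norm_le_sum:
  assumes "\<And>i. i \<in> I \<Longrightarrow> fps_norm_le K (F i) (B i)" "K > 0"
  shows "fps_norm_le K (sum F I) (sum B I)"
  using assms(1)
  by (induction I rule: infinite_finite_induct) (auto intro: fps_norm_le_0 fps_norm_le_add assms(2))

lemma fps_norm_le_mult:
  assumes "fps_norm_le K F B" "fps_norm_le K G C" "K > 0"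
  shows "fps_norm_le K (F * G) (B * C)"
  unfolding fps_norm_le_def
proof
  fix N
  let ?f = "\<lambda>i. \<bar>fps_nth F i\<bar> * K ^ i" and ?g = "\<lambda>i. \<bar>fps_nth G i\<bar> * K ^ i"
  have "(\<Sum>k<N. \<bar>fps_nth (F * G) k\<bar> * K ^ k) \<le> (\<Sum>k<N. \<Sum>i\<le>k. ?f i * ?g (k - i))"
  proof (rule sum_mono)
    fix k
    have "\<bar>fps_nth (F * G) k\<bar> * K ^ k \<le> (\<Sum>i\<le>k. \<bar>fps_nth F i * fps_nth G (k - i)\<bar>) * K ^ k"
      unfolding fps_mult_nth atLeast0AtMost using assms(3)
      by (intro mult_right_mono sum_abs) auto
    also have "\<dots> = (\<Sum>i\<le>k. ?f i * ?g (k - i))"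
      unfolding sum_distrib_right
      by (rule sum.cong) (auto simp: abs_mult simp flip: power_add)
    finally show "\<bar>fps_nth (F * G) k\<bar> * K ^ k \<le> (\<Sum>i\<le>k. ?f i * ?g (k - i))" .
  qed
  also have "\<dots> = (\<Sum>(i,j)\<in>{(i,j). i + j < N}. ?f i * ?g j)"
    by (rule sum.triangle_reindex[symmetric])
  also have "\<dots> \<le> (\<Sum>(i,j)\<in>{..<N} \<times> {..<N}. ?f i * ?g j)"
    using assms(3) by (intro sum_mono2) (auto simp: split_beta)
  also have "\<dots> = (\<Sum>i<N. ?f i) * (\<Sum>i<N. ?g i)"
    by (simp add: sum_product sum.cartesian_product)
  also have "\<dots> \<le> B * C"
    using assms(3) by (intro mult_mono fps_norm_leD assms fps_norm_le_nonneg[OF assms(1)] sum_nonneg) auto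
  finally show "(\<Sum>k<N. \<bar>fps_nth (F * G) k\<bar> * K ^ k) \<le> B * C" .
qed

lemma fps_norm_le_const: "fps_norm_le K (fps_const c) \<bar>c\<bar>"
  unfolding fps_norm_le_def
proof
  fix N show "(\<Sum>k<N. \<bar>fps_nth (fps_const c) k\<bar> * K ^ k) \<le> \<bar>c\<bar>"
    by (cases N) (auto simp: sum.lessThan_Suc_shift simp del: sum.lessThan_Suc)
qed

lemma fps_norm_le_X_power: "K > 0 \<Longrightarrow> fps_norm_le K (fps_X ^ n) (K ^ n)"
  unfolding fps_norm_le_def
proof
  fix N assume "K > 0"
  have "(\<Sum>k<N. \<bar>fps_nth (fps_X ^ n) k\<bar> * K ^ k) = (\<Sum>k<N. if k = n then K ^ n else 0)"
    by (rule sum.cong) (auto simp: fps_X_power_nth)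
  then show "(\<Sum>k<N. \<bar>fps_nth (fps_X ^ n) k\<bar> * K ^ k) \<le> K ^ n"
    using \<open>K > 0\<close> by simp
qed

lemma fps_norm_le_power: "fps_norm_le K F B \<Longrightarrow> K > 0 \<Longrightarrow> fps_norm_le K (F ^ l) (B ^ l)"
  by (induction l) (use fps_norm_le_const[of K 1] in \<open>auto intro: fps_norm_le_mult\<close>)

lemma fps_norm_le_shift:
  assumes "fps_norm_le K F B" "K > 0"
  shows "fps_norm_le K (fps_shift n F) (B / K ^ n)"
  unfolding fps_norm_le_def
proof
  fix N
  have "(\<Sum>k<N. \<bar>fps_nth (fps_shift n F) k\<bar> * K ^ k) * K ^ n
      = (\<Sum>k<N. \<bar>fps_nth F (k + n)\<bar> * K ^ (k + n))"
    by (simp add: sum_distrib_right power_add mult.assoc)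
  also have "\<dots> = (\<Sum>k\<in>{n..<N + n}. \<bar>fps_nth F k\<bar> * K ^ k)"
    using sum.shift_bounds_nat_ivl[of "\<lambda>k. \<bar>fps_nth F k\<bar> * K ^ k" 0 n N] by (simp add: atLeast0LessThan)
  also have "\<dots> \<le> (\<Sum>k<N + n. \<bar>fps_nth F k\<bar> * K ^ k)"
    using assms by (intro sum_mono2) auto
  also have "\<dots> \<le> B" by (rule fps_norm_leD[OF assms(1)])
  finally show "(\<Sum>k<N. \<bar>fps_nth (fps_shift n F) k\<bar> * K ^ k) \<le> B / K ^ n"
    using assms(2) by (simp add: field_simps)
qed

lemma fps_norm_le_abs_le:
  assumes "fps_norm_le K F B" "K > 0" "\<And>k. \<bar>fps_nth G k\<bar> \<le> \<bar>fps_nth F k\<bar>"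
  shows "fps_norm_le K G B"
  unfolding fps_norm_le_def
  by (intro allI order_trans[OF sum_mono fps_norm_leD[OF assms(1)]] mult_right_mono assms)
     (use assms(2) in auto)

lemma fps_norm_le_cutoff:
  "fps_norm_le K F B \<Longrightarrow> K > 0 \<Longrightarrow> fps_norm_le K (fps_cutoff n F) B"
  by (erule fps_norm_le_abs_le) auto

text \<open>Completeness of the weighted algebra, the form in which infinite series are summed
  throughout. Only finitely many coefficients are added at a time, so the sum over \<open>k\<close>
  and the series over \<open>l\<close> are exchanged without a Fubini argument.\<close>

lemma fps_norm_le_suminf:
  assumes "\<And>l. fps_norm_le K (F l) (B l)" "summable B" "K > 0"
  shows "summable (\<lambda>l. fps_nth (F l) k)"
    and "fps_norm_le K (Abs_fps (\<lambda>k. \<Sum>l. fps_nth (F l) k)) (suminf B)"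
proof -
  have sa: "summable (\<lambda>l. \<bar>fps_nth (F l) k\<bar>)" for k
    by (rule summable_comparison_test'[where N = 0 and g = "\<lambda>l. B l / K ^ k"])
       (use assms in \<open>auto intro: fps_norm_le_nth summable_divide\<close>)
  then show "summable (\<lambda>l. fps_nth (F l) k)" by (rule summable_rabs_cancel)
  show "fps_norm_le K (Abs_fps (\<lambda>k. \<Sum>l. fps_nth (F l) k)) (suminf B)"
    unfolding fps_norm_le_def
  proof
    fix N
    have "(\<Sum>k<N. \<bar>fps_nth (Abs_fps (\<lambda>k. \<Sum>l. fps_nth (F l) k)) k\<bar> * K ^ k)
       \<le> (\<Sum>k<N. (\<Sum>l. \<bar>fps_nth (F l) k\<bar>) * K ^ k)"
      using assms(3) by (intro sum_mono mult_right_mono) (auto intro: summable_rabs[OF sa])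
    also have "\<dots> = (\<Sum>k<N. (\<Sum>l. \<bar>fps_nth (F l) k\<bar> * K ^ k))"
      by (simp add: suminf_mult2 sa)
    also have "\<dots> = (\<Sum>l. \<Sum>k<N. \<bar>fps_nth (F l) k\<bar> * K ^ k)"
      by (rule suminf_sum[symmetric]) (simp add: sa summable_mult2)
    also have "\<dots> \<le> suminf B"
      by (intro suminf_le fps_norm_leD assms summable_sum summable_mult2 sa)
    finally show "(\<Sum>k<N. \<bar>fps_nth (Abs_fps (\<lambda>k. \<Sum>l. fps_nth (F l) k)) k\<bar> * K ^ k) \<le> suminf B" .
  qed
qed

text \<open>The norm is present only through its upper bounds, so contraction is phrased as an
  improvement of every bound. The a priori bound \<open>B\<close> starts the iteration; a series of
  infinite norm would satisfy the last assumption vacuously.\<close>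

lemma fps_eq_0_of_contraction:
  assumes "fps_norm_le K F B" "K > 0" "0 \<le> \<theta>" "\<theta> < 1"
    and "\<And>C. fps_norm_le K F C \<Longrightarrow> fps_norm_le K F (\<theta> * C)"
  shows "F = 0"
proof (rule fps_ext)
  fix k
  have "fps_norm_le K F (\<theta> ^ l * B)" for l
    by (induction l) (use assms in \<open>auto simp: mult.assoc\<close>)
  then have "\<bar>fps_nth F k\<bar> \<le> \<theta> ^ l * B / K ^ k" for l
    using assms(2) fps_norm_le_nth by blast
  moreover have "(\<lambda>l. \<theta> ^ l * B / K ^ k) \<longlonglongrightarrow> 0 * B / K ^ k"
    using assms by (intro tendsto_intros LIMSEQ_realpow_zero) auto
  ultimately have "\<bar>fps_nth F k\<bar> \<le> 0 * B / K ^ k"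
    by (intro LIMSEQ_le_const) auto
  then show "fps_nth F k = fps_nth 0 k" by simp
qed

text \<open>A Neumann series estimate for the formal inverse, about whose norm nothing is known
  beforehand. Truncation supplies a finite quantity: coefficients of (1 - F) I below
  \<open>N\<close> involve only those of I below \<open>N\<close>, so the partial norm satisfies S
  \<le> 1 + \<theta> S and can be solved for.\<close>

lemma fps_inverse_norm_le:
  assumes "fps_norm_le K (1 - F) \<theta>" "\<theta> < 1" "K > 0"
  shows "fps_nth F 0 \<noteq> 0" and "fps_norm_le K (inverse F) (1 / (1 - \<theta>))"
proof -
  show nz: "fps_nth F 0 \<noteq> 0"
    using fps_norm_le_nth[OF assms(1,3), of 0] assms(2) by auto
  let ?I = "inverse F"
  have eq: "?I = 1 + (1 - F) * ?I"
    using inverse_mult_eq_1'[OF nz] by (simp add: algebra_simps)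
  show "fps_norm_le K ?I (1 / (1 - \<theta>))"
    unfolding fps_norm_le_def
  proof
    fix N
    let ?J = "fps_cutoff N ?I"
    define S where "S = (\<Sum>k<N. \<bar>fps_nth ?I k\<bar> * K ^ k)"
    have "fps_norm_le K ?J S"
      unfolding fps_norm_le_def
    proof
      fix M
      have "(\<Sum>k<M. \<bar>fps_nth ?J k\<bar> * K ^ k) \<le> (\<Sum>k<M+N. \<bar>fps_nth ?J k\<bar> * K ^ k)"
        using assms(3) by (intro sum_mono2) auto
      also have "\<dots> = S" unfolding S_def by (intro sum.mono_neutral_cong_right) auto
      finally show "(\<Sum>k<M. \<bar>fps_nth ?J k\<bar> * K ^ k) \<le> S" .
    qed
    then have "fps_norm_le K (1 + (1 - F) * ?J) (1 + \<theta> * S)"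
      using assms fps_norm_le_const[of K 1] by (intro fps_norm_le_add fps_norm_le_mult) auto
    then have "(\<Sum>k<N. \<bar>fps_nth (1 + (1 - F) * ?J) k\<bar> * K ^ k) \<le> 1 + \<theta> * S"
      by (rule fps_norm_leD)
    moreover have "fps_nth (1 + (1 - F) * ?J) k = fps_nth ?I k" if "k < N" for k
    proof -
      have "fps_nth ((1 - F) * ?J) k = fps_nth ((1 - F) * ?I) k"
        unfolding fps_mult_nth using that by (intro sum.cong) auto
      then show ?thesis by (subst (2) eq) simp
    qed
    ultimately have "S \<le> 1 + \<theta> * S" by (simp add: S_def)
    then show "S \<le> 1 / (1 - \<theta>)"
      using assms(2) by (simp add: field_simps)
  qed
qed

section \<open>Weierstrass division by \<open>X\<^sup>n - w\<close>\<close>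

text \<open>Rewriting \<open>X\<^sup>n F\<close> as \<open>(X\<^sup>n - w) F + w F\<close> and iterating contracts the undivided part by
  \<open>\<parallel>w\<parallel> / K\<^sup>n\<close>. The series for quotient and remainder use only products, shifts and sums, so they can
  be majorized coefficientwise.\<close>

primrec wdiv_iter :: "nat \<Rightarrow> real fps \<Rightarrow> real fps \<Rightarrow> nat \<Rightarrow> real fps" where
  "wdiv_iter n w g 0 = g"
| "wdiv_iter n w g (Suc k) = w * fps_shift n (wdiv_iter n w g k)"

definition wdiv_quot :: "nat \<Rightarrow> real fps \<Rightarrow> real fps \<Rightarrow> real fps" where
  "wdiv_quot n w g = Abs_fps (\<lambda>a. \<Sum>k. fps_nth (wdiv_iter n w g k) (a + n))"

definition wdiv_rem :: "nat \<Rightarrow> real fps \<Rightarrow> real fps \<Rightarrow> real fps" where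
  "wdiv_rem n w g = Abs_fps (\<lambda>a. if a < n then \<Sum>k. fps_nth (wdiv_iter n w g k) a else 0)"

context
  fixes K \<theta> B :: real and n :: nat and w g :: "real fps"
  assumes K: "K > 0" and \<theta>: "0 \<le> \<theta>" "\<theta> < 1"
    and w: "fps_norm_le K w (\<theta> * K ^ n)" and g: "fps_norm_le K g B"
begin

lemma wdiv_iter_norm_le: "fps_norm_le K (wdiv_iter n w g k) (\<theta> ^ k * B)"
proof (induction k)
  case (Suc k)
  have "fps_norm_le K (wdiv_iter n w g (Suc k)) (\<theta> * K ^ n * (\<theta> ^ k * B / K ^ n))"
    unfolding wdiv_iter.simps by (intro fps_norm_le_mult w fps_norm_le_shift Suc K)
  then show ?case using K by (simp add: mult.assoc)
qed (simp add: g)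

lemma wdiv_iter_summable: "summable (\<lambda>k. fps_nth (wdiv_iter n w g k) a)"
  by (rule fps_norm_le_suminf(1)[OF wdiv_iter_norm_le])
     (use \<theta> K in \<open>auto intro!: summable_mult2 summable_geometric\<close>)

lemma wdiv_quot_norm_le: "\<exists>C. fps_norm_le K (wdiv_quot n w g) C"
proof -
  have "fps_norm_le K (Abs_fps (\<lambda>a. \<Sum>k. fps_nth (fps_shift n (wdiv_iter n w g k)) a))
      (\<Sum>k. \<theta> ^ k * B / K ^ n)"
    by (rule fps_norm_le_suminf(2)[OF fps_norm_le_shift[OF wdiv_iter_norm_le K]])
       (use \<theta> K in \<open>auto intro!: summable_mult2 summable_geometric summable_divide\<close>)
  then show ?thesis by (auto simp: wdiv_quot_def)
qed

text \<open>A telescoping sum. The quotient is the part from index \<open>n\<close> on of the sum of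
  all iterates, shifted down; multiplying it by X^n and adding the remainder restores that sum,
  while multiplying it by \<open>w\<close> yields all iterates except the initial one, which is
  \<open>g\<close>.\<close>

lemma weierstrass_division: "g = wdiv_quot n w g * (fps_X ^ n - w) + wdiv_rem n w g"
proof (rule fps_ext)
  fix b
  let ?it = "wdiv_iter n w g"
  let ?S = "\<Sum>k. fps_nth (?it k) b"
  have 1: "fps_nth (wdiv_quot n w g * fps_X ^ n) b + fps_nth (wdiv_rem n w g) b = ?S"
    by (auto simp: wdiv_quot_def wdiv_rem_def fps_X_power_mult_right_nth)
  have "fps_nth (wdiv_quot n w g * w) b
      = (\<Sum>i=0..b. \<Sum>k. fps_nth (?it k) (i + n) * fps_nth w (b - i))"
    by (simp add: fps_mult_nth wdiv_quot_def suminf_mult2 wdiv_iter_summable)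
  also have "\<dots> = (\<Sum>k. \<Sum>i=0..b. fps_nth (?it k) (i + n) * fps_nth w (b - i))"
    by (rule suminf_sum[symmetric]) (intro summable_mult2 wdiv_iter_summable)
  also have "\<dots> = (\<Sum>k. fps_nth (?it (Suc k)) b)"
    by (simp add: mult.commute[of w] fps_mult_nth)
  also have "\<dots> = ?S - fps_nth g b"
    using suminf_split_head[OF wdiv_iter_summable[of b]] by simp
  finally show "fps_nth g b = fps_nth (wdiv_quot n w g * (fps_X ^ n - w) + wdiv_rem n w g) b"
    using 1 by (simp add: algebra_simps)
qed

end

text \<open>The coefficients from index \<open>n\<close> on say that \<open>h\<close> is the shift
  by \<open>n\<close> of h w, an operation contracting the norm by \<theta>. The finite norm of
  \<open>h\<close> is decisive: for n = 1 and w = 1 the formal inverse of X - 1 is a nonzero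
  \<open>h\<close> with product 1, but its norm is infinite for K > 1.\<close>

lemma weierstrass_quotient_unique:
  assumes "K > 0" "0 \<le> \<theta>" "\<theta> < 1" "fps_norm_le K w (\<theta> * K ^ n)" "fps_norm_le K h B"
    and low: "\<And>k. k \<ge> n \<Longrightarrow> fps_nth (h * (fps_X ^ n - w)) k = 0"
  shows "h = 0"
proof (rule fps_eq_0_of_contraction)
  have h: "h = fps_shift n (h * w)"
  proof (rule fps_ext)
    fix k show "fps_nth h k = fps_nth (fps_shift n (h * w)) k"
      using low[of "k + n"] by (simp add: right_diff_distrib fps_X_power_mult_right_nth)
  qed
  fix C assume "fps_norm_le K h C"
  then have "fps_norm_le K (fps_shift n (h * w)) (C * (\<theta> * K ^ n) / K ^ n)"
    using assms by (intro fps_norm_le_shift fps_norm_le_mult)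
  then show "fps_norm_le K h (\<theta> * C)"
    using h assms(1) by (simp add: mult.commute)
qed (use assms in auto)

section \<open>Expansions of functions of several variables\<close>

definition monomial :: "('n::finite \<Rightarrow> nat) \<Rightarrow> real ^ 'n \<Rightarrow> real" where
  "monomial \<alpha> z = (\<Prod>k\<in>UNIV. (z $ k) ^ \<alpha> k)"

text \<open>A closed cube, because the absolute sum at its corner dominates the series at every
  other point. \<open>B\<close> is carried along so that it can become a coefficient of a majorant
  series: it behaves additively and multiplicatively, and it bounds the function on the
  cube.\<close>

definition ps_expansion ::
    "real ^ 'n::finite \<Rightarrow> real \<Rightarrow> (('n \<Rightarrow> nat) \<Rightarrow> real) \<Rightarrow> real \<Rightarrow> (real ^ 'n \<Rightarrow> real) \<Rightarrow> bool" where
  "ps_expansion a \<rho> c B g \<longleftrightarrow>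
     (\<exists>S\<le>B. ((\<lambda>\<alpha>. \<bar>c \<alpha>\<bar> * \<rho> ^ sum \<alpha> UNIV) has_sum S) UNIV) \<and>
     (\<forall>y. (\<forall>k. \<bar>y $ k - a $ k\<bar> \<le> \<rho>) \<longrightarrow> ((\<lambda>\<alpha>. c \<alpha> * monomial \<alpha> (y - a)) has_sum g y) UNIV)"

lemma monomial_add: "monomial (\<lambda>k. \<alpha> k + \<beta> k) z = monomial \<alpha> z * monomial \<beta> z"
  by (simp add: monomial_def power_add prod.distrib)

lemma monomial_zero [simp]: "monomial (\<lambda>_. 0) z = 1"
  by (simp add: monomial_def)

lemma abs_monomial_le:
  assumes "\<And>k. \<bar>z $ k\<bar> \<le> \<rho>"
  shows "\<bar>monomial \<alpha> z\<bar> \<le> \<rho> ^ sum \<alpha> UNIV"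
proof -
  have "\<bar>monomial \<alpha> z\<bar> = (\<Prod>k\<in>UNIV. \<bar>z $ k\<bar> ^ \<alpha> k)"
    by (simp add: monomial_def abs_prod power_abs)
  also have "\<dots> \<le> (\<Prod>k\<in>UNIV. \<rho> ^ \<alpha> k)"
    by (intro prod_mono) (auto intro: power_mono assms)
  finally show ?thesis by (simp add: power_sum)
qed

lemma abs_le_of_has_sum:
  fixes f g :: "'a \<Rightarrow> real"
  assumes "(f has_sum a) A" "(g has_sum b) A" "\<And>x. x \<in> A \<Longrightarrow> \<bar>f x\<bar> \<le> g x"
  shows "\<bar>a\<bar> \<le> b"
proof -
  have "a \<le> b" by (rule has_sum_mono[OF assms(1,2)]) (use assms(3) in force)
  moreover have "- b \<le> a"
    by (rule has_sum_mono[OF has_sum_uminusI[OF assms(2)] assms(1)]) (use assms(3) in force)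
  ultimately show ?thesis by auto
qed

lemma ps_expansion_has_sum:
  "ps_expansion a \<rho> c B g \<Longrightarrow> (\<And>k. \<bar>y $ k - a $ k\<bar> \<le> \<rho>) \<Longrightarrow>
     ((\<lambda>\<alpha>. c \<alpha> * monomial \<alpha> (y - a)) has_sum g y) UNIV"
  by (simp add: ps_expansion_def)

lemma ps_expansion_mono: "ps_expansion a \<rho> c B g \<Longrightarrow> B \<le> C \<Longrightarrow> ps_expansion a \<rho> c C g"
  unfolding ps_expansion_def by (meson order_trans)

lemma ps_expansion_bound:
  assumes "ps_expansion a \<rho> c B g" "\<And>k. \<bar>y $ k - a $ k\<bar> \<le> \<rho>"
  shows "\<bar>g y\<bar> \<le> B"
proof -
  from assms(1) obtain S where S: "S \<le> B" "((\<lambda>\<alpha>. \<bar>c \<alpha>\<bar> * \<rho> ^ sum \<alpha> UNIV) has_sum S) UNIV"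
    by (auto simp: ps_expansion_def)
  have "\<bar>g y\<bar> \<le> S"
    by (rule abs_le_of_has_sum[OF ps_expansion_has_sum[OF assms] S(2)])
       (auto simp: abs_mult intro!: mult_left_mono abs_monomial_le assms(2))
  with S show ?thesis by simp
qed

lemma ps_expansion_nonneg:
  assumes "ps_expansion a \<rho> c B g" "\<rho> \<ge> 0"
  shows "B \<ge> 0"
  using ps_expansion_bound[OF assms(1), of a] assms(2) by simp

lemma ps_expansion_const: "ps_expansion a \<rho> (\<lambda>\<alpha>. if \<alpha> = (\<lambda>_. 0) then C else 0) \<bar>C\<bar> (\<lambda>_. C)"
  unfolding ps_expansion_def
proof safe
  show "\<exists>S\<le>\<bar>C\<bar>. ((\<lambda>\<alpha>. \<bar>if \<alpha> = (\<lambda>_. 0) then C else 0\<bar> * \<rho> ^ sum \<alpha> UNIV) has_sum S) UNIV"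
    by (intro exI[of _ "\<bar>C\<bar>"] conjI order_refl
        has_sum_finite_neutralI[where B = "{\<lambda>_. 0}"]) auto
  fix y :: "real ^ 'a"
  show "((\<lambda>\<alpha>. (if \<alpha> = (\<lambda>_. 0) then C else 0) * monomial \<alpha> (y - a)) has_sum C) UNIV"
    by (intro has_sum_finite_neutralI[where B = "{\<lambda>_. 0}"]) auto
qed

lemma ps_expansion_zero: "B \<ge> 0 \<Longrightarrow> ps_expansion a \<rho> (\<lambda>_. 0) B (\<lambda>_. 0)"
  using ps_expansion_const[of a \<rho> 0] by (auto intro: ps_expansion_mono)

definition unit_index :: "'n \<Rightarrow> nat \<Rightarrow> 'n \<Rightarrow> nat" where
  "unit_index j m = (\<lambda>k. if k = j then m else 0)"

lemma sum_unit_index [simp]: "sum (unit_index (j::'n::finite) m) UNIV = m"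
  by (simp add: unit_index_def)

lemma monomial_unit_index [simp]: "monomial (unit_index j m) z = (z $ j) ^ m"
proof -
  have "monomial (unit_index j m) z = (\<Prod>k\<in>UNIV. if k = j then (z $ j) ^ m else 1)"
    unfolding monomial_def by (rule prod.cong) (auto simp: unit_index_def)
  then show ?thesis by simp
qed

lemma unit_index_eq_iff [simp]: "unit_index j m = unit_index j l \<longleftrightarrow> m = l"
  by (metis unit_index_def)

lemma unit_index_0 [simp]: "unit_index j 0 = (\<lambda>_. 0)"
  by (auto simp: unit_index_def)

text \<open>The bound is the largest absolute value of the coordinate on the cube. Requiring it to
  be at most \<epsilon> is what later ties the radius \<rho> to the distance of \<open>a\<close>
  from the boundary of the parameter domain.\<close>

lemma ps_expansion_coord:
  assumes "\<rho> > 0"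
  shows "ps_expansion a \<rho>
    (\<lambda>\<alpha>. if \<alpha> = unit_index j 0 then a $ j else if \<alpha> = unit_index j 1 then 1 else 0)
    (\<bar>a $ j\<bar> + \<rho>) (\<lambda>x. x $ j)"
    (is "ps_expansion _ _ ?c _ _")
  unfolding ps_expansion_def
proof (intro conjI allI impI)
  have ne: "unit_index j 1 \<noteq> unit_index j 0" by (simp del: unit_index_0)
  show "\<exists>S\<le>\<bar>a $ j\<bar> + \<rho>. ((\<lambda>\<alpha>. \<bar>?c \<alpha>\<bar> * \<rho> ^ sum \<alpha> UNIV) has_sum S) UNIV"
    using ne by (intro exI[of _ "\<bar>a $ j\<bar> + \<rho>"] conjI order_refl
        has_sum_finite_neutralI[where B = "{unit_index j 0, unit_index j 1}"])
       (auto simp del: unit_index_0)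
  fix y :: "real ^ 'a"
  show "((\<lambda>\<alpha>. ?c \<alpha> * monomial \<alpha> (y - a)) has_sum y $ j) UNIV"
    using ne by (intro has_sum_finite_neutralI[where B = "{unit_index j 0, unit_index j 1}"])
      (auto simp del: unit_index_0)
qed

section \<open>Sums, products and infinite series of expansions\<close>

lemma ps_expansion_add:
  assumes "ps_expansion a \<rho> c B g" "ps_expansion a \<rho> d C h" "\<rho> > 0"
  shows "ps_expansion a \<rho> (\<lambda>\<alpha>. c \<alpha> + d \<alpha>) (B + C) (\<lambda>y. g y + h y)"
  unfolding ps_expansion_def
proof (intro conjI allI impI)
  from assms obtain S T where
    S: "S \<le> B" "((\<lambda>\<alpha>. \<bar>c \<alpha>\<bar> * \<rho> ^ sum \<alpha> UNIV) has_sum S) UNIV" and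
    T: "T \<le> C" "((\<lambda>\<alpha>. \<bar>d \<alpha>\<bar> * \<rho> ^ sum \<alpha> UNIV) has_sum T) UNIV"
    by (auto simp: ps_expansion_def)
  note st = has_sum_add[OF S(2) T(2)]
  have le: "\<bar>c \<alpha> + d \<alpha>\<bar> * \<rho> ^ sum \<alpha> UNIV \<le> \<bar>c \<alpha>\<bar> * \<rho> ^ sum \<alpha> UNIV + \<bar>d \<alpha>\<bar> * \<rho> ^ sum \<alpha> UNIV" for \<alpha>
    using assms(3) by (simp flip: distrib_right add: mult_right_mono)
  have "(\<lambda>\<alpha>. \<bar>c \<alpha> + d \<alpha>\<bar> * \<rho> ^ sum \<alpha> UNIV) summable_on UNIV"
    by (rule summable_on_comparison_test[OF has_sum_imp_summable[OF st]]) (use le assms(3) in auto)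
  then obtain R where R: "((\<lambda>\<alpha>. \<bar>c \<alpha> + d \<alpha>\<bar> * \<rho> ^ sum \<alpha> UNIV) has_sum R) UNIV"
    by (auto simp: summable_on_def)
  have "R \<le> S + T" by (rule has_sum_mono[OF R st]) (rule le)
  with R S T show "\<exists>S\<le>B + C. ((\<lambda>\<alpha>. \<bar>c \<alpha> + d \<alpha>\<bar> * \<rho> ^ sum \<alpha> UNIV) has_sum S) UNIV"
    by (intro exI[of _ R]) auto
next
  fix y assume "\<forall>k. \<bar>y $ k - a $ k\<bar> \<le> \<rho>"
  then show "((\<lambda>\<alpha>. (c \<alpha> + d \<alpha>) * monomial \<alpha> (y - a)) has_sum g y + h y) UNIV"
    using has_sum_add[OF ps_expansion_has_sum[OF assms(1)] ps_expansion_has_sum[OF assms(2)], of y]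
    by (simp add: distrib_right)
qed

lemma has_sum_product_real:
  fixes f :: "'a \<Rightarrow> real" and g :: "'b \<Rightarrow> real"
  assumes "(f has_sum F) A" "(g has_sum G) B"
  shows "((\<lambda>(x, y). f x * g y) has_sum F * G) (A \<times> B)"
proof (rule has_sum_SigmaI)
  show "((\<lambda>y. case (x, y) of (x, y) \<Rightarrow> f x * g y) has_sum f x * G) B" for x
    using has_sum_cmult_right[OF assms(2)] by simp
  show "((\<lambda>x. f x * G) has_sum F * G) A"
    by (rule has_sum_cmult_left[OF assms(1)])
  from assms have fg: "(\<lambda>x. norm (f x)) summable_on A" "(\<lambda>x. norm (g x)) summable_on B"
    using summable_on_iff_abs_summable_on_real has_sum_imp_summable by blast+
  then have g: "((\<lambda>x. norm (g x)) has_sum (\<Sum>\<^sub>\<infinity>x\<in>B. norm (g x))) B"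
    by (intro has_sum_infsum)
  have "(\<lambda>z. norm (case z of (x, y) \<Rightarrow> f x * g y)) summable_on (A \<times> B)"
    by (rule summable_on_SigmaI[where g = "\<lambda>x. norm (f x) * (\<Sum>\<^sub>\<infinity>x\<in>B. norm (g x))"])
       (use has_sum_cmult_right[OF g] fg in \<open>auto simp: abs_mult intro: summable_on_cmult_left\<close>)
  then show "(\<lambda>(x, y). f x * g y) summable_on A \<times> B"
    using summable_on_iff_abs_summable_on_real by blast
qed

definition index_below :: "('n::finite \<Rightarrow> nat) \<Rightarrow> ('n \<Rightarrow> nat) set" where
  "index_below \<gamma> = {\<alpha>. \<forall>k. \<alpha> k \<le> \<gamma> k}"

lemma finite_index_below: "finite (index_below \<gamma>)"
proof -
  have "index_below \<gamma> = (\<Pi>\<^sub>E k\<in>UNIV. {..\<gamma> k})" by (auto simp: index_below_def PiE_def)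
  then show ?thesis by (simp add: finite_PiE)
qed

text \<open>Regroups a double series by \<gamma> = \<alpha> + \<beta>. For fixed \<gamma> there are
  only finitely many \<alpha> below it, and for these the truncated subtraction of naturals is
  exact.\<close>

lemma has_sum_index_convolution:
  fixes F :: "('n::finite \<Rightarrow> nat) \<Rightarrow> ('n \<Rightarrow> nat) \<Rightarrow> real"
  assumes "((\<lambda>(\<alpha>, \<beta>). F \<alpha> \<beta>) has_sum S) (UNIV \<times> UNIV)"
  shows "((\<lambda>\<gamma>. \<Sum>\<alpha>\<in>index_below \<gamma>. F \<alpha> (\<lambda>k. \<gamma> k - \<alpha> k)) has_sum S) UNIV"
proof -
  have "((\<lambda>(\<gamma>, \<alpha>). F \<alpha> (\<lambda>k. \<gamma> k - \<alpha> k)) has_sum S) (Sigma UNIV index_below)"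
    using assms
    by (subst has_sum_reindex_bij_witness[where T = "UNIV \<times> UNIV" and s' = S and
          h = "\<lambda>(\<alpha>, \<beta>). F \<alpha> \<beta>" and j = "\<lambda>(\<gamma>, \<alpha>). (\<alpha>, \<lambda>k. \<gamma> k - \<alpha> k)" and
          i = "\<lambda>(\<alpha>, \<beta>). (\<lambda>k. \<alpha> k + \<beta> k, \<alpha>)"])
       (auto simp: index_below_def)
  then show ?thesis
    by (rule has_sum_SigmaD) (auto intro!: has_sum_finiteI finite_index_below)
qed

lemma ps_expansion_mult:
  assumes "ps_expansion a \<rho> c B g" "ps_expansion a \<rho> d C h" "\<rho> > 0"
  shows "ps_expansion a \<rho> (\<lambda>\<gamma>. \<Sum>\<alpha>\<in>index_below \<gamma>. c \<alpha> * d (\<lambda>k. \<gamma> k - \<alpha> k)) (B * C) (\<lambda>y. g y * h y)"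
    (is "ps_expansion _ _ ?e _ _")
  unfolding ps_expansion_def
proof (intro conjI allI impI)
  from assms obtain S T where
    S: "S \<le> B" "((\<lambda>\<alpha>. \<bar>c \<alpha>\<bar> * \<rho> ^ sum \<alpha> UNIV) has_sum S) UNIV" and
    T: "T \<le> C" "((\<lambda>\<alpha>. \<bar>d \<alpha>\<bar> * \<rho> ^ sum \<alpha> UNIV) has_sum T) UNIV"
    by (auto simp: ps_expansion_def)
  note st = has_sum_index_convolution[OF has_sum_product_real[OF S(2) T(2)]]
  have le: "\<bar>?e \<gamma>\<bar> * \<rho> ^ sum \<gamma> UNIV \<le> (\<Sum>\<alpha>\<in>index_below \<gamma>.
      \<bar>c \<alpha>\<bar> * \<rho> ^ sum \<alpha> UNIV * (\<bar>d (\<lambda>k. \<gamma> k - \<alpha> k)\<bar> * \<rho> ^ (\<Sum>k\<in>UNIV. \<gamma> k - \<alpha> k)))" for \<gamma>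
  proof -
    have "\<bar>?e \<gamma>\<bar> * \<rho> ^ sum \<gamma> UNIV \<le>
        (\<Sum>\<alpha>\<in>index_below \<gamma>. \<bar>c \<alpha> * d (\<lambda>k. \<gamma> k - \<alpha> k)\<bar>) * \<rho> ^ sum \<gamma> UNIV"
      using assms(3) by (intro mult_right_mono sum_abs) auto
    also have "\<dots> = (\<Sum>\<alpha>\<in>index_below \<gamma>.
      \<bar>c \<alpha>\<bar> * \<rho> ^ sum \<alpha> UNIV * (\<bar>d (\<lambda>k. \<gamma> k - \<alpha> k)\<bar> * \<rho> ^ (\<Sum>k\<in>UNIV. \<gamma> k - \<alpha> k)))"
      unfolding sum_distrib_right
    proof (rule sum.cong[OF refl])
      fix \<alpha> assume "\<alpha> \<in> index_below \<gamma>"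
      then have "sum \<alpha> UNIV + (\<Sum>k\<in>UNIV. \<gamma> k - \<alpha> k) = sum \<gamma> UNIV"
        by (simp add: index_below_def flip: sum.distrib)
      then have "\<rho> ^ sum \<gamma> UNIV = \<rho> ^ sum \<alpha> UNIV * \<rho> ^ (\<Sum>k\<in>UNIV. \<gamma> k - \<alpha> k)"
        by (simp flip: power_add)
      then show "\<bar>c \<alpha> * d (\<lambda>k. \<gamma> k - \<alpha> k)\<bar> * \<rho> ^ sum \<gamma> UNIV =
        \<bar>c \<alpha>\<bar> * \<rho> ^ sum \<alpha> UNIV * (\<bar>d (\<lambda>k. \<gamma> k - \<alpha> k)\<bar> * \<rho> ^ (\<Sum>k\<in>UNIV. \<gamma> k - \<alpha> k))"
        by (simp add: abs_mult)
    qed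
    finally show ?thesis .
  qed
  have "(\<lambda>\<gamma>. \<bar>?e \<gamma>\<bar> * \<rho> ^ sum \<gamma> UNIV) summable_on UNIV"
    by (rule summable_on_comparison_test[OF has_sum_imp_summable[OF st]]) (use le assms(3) in auto)
  then obtain R where R: "((\<lambda>\<gamma>. \<bar>?e \<gamma>\<bar> * \<rho> ^ sum \<gamma> UNIV) has_sum R) UNIV"
    by (auto simp: summable_on_def)
  have "R \<le> S * T" by (rule has_sum_mono[OF R st]) (rule le)
  also have "\<dots> \<le> B * C"
  proof (rule mult_mono)
    show "0 \<le> T" by (rule has_sum_nonneg[OF T(2)]) (use assms(3) in auto)
    show "0 \<le> B" by (rule ps_expansion_nonneg[OF assms(1)]) (use assms(3) in auto)
  qed (use S T in auto)
  finally show "\<exists>S\<le>B * C. ((\<lambda>\<gamma>. \<bar>?e \<gamma>\<bar> * \<rho> ^ sum \<gamma> UNIV) has_sum S) UNIV"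
    using R by blast
next
  fix y assume "\<forall>k. \<bar>y $ k - a $ k\<bar> \<le> \<rho>"
  then have "((\<lambda>(\<alpha>, \<beta>). (c \<alpha> * monomial \<alpha> (y - a)) * (d \<beta> * monomial \<beta> (y - a))) has_sum g y * h y) (UNIV \<times> UNIV)"
    by (intro has_sum_product_real ps_expansion_has_sum[OF assms(1)] ps_expansion_has_sum[OF assms(2)]) auto
  from has_sum_index_convolution[OF this]
  have "((\<lambda>\<gamma>. \<Sum>\<alpha>\<in>index_below \<gamma>. c \<alpha> * monomial \<alpha> (y - a) *
       (d (\<lambda>k. \<gamma> k - \<alpha> k) * monomial (\<lambda>k. \<gamma> k - \<alpha> k) (y - a))) has_sum g y * h y) UNIV" .
  also have "(\<lambda>\<gamma>. \<Sum>\<alpha>\<in>index_below \<gamma>. c \<alpha> * monomial \<alpha> (y - a) *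
       (d (\<lambda>k. \<gamma> k - \<alpha> k) * monomial (\<lambda>k. \<gamma> k - \<alpha> k) (y - a)))
     = (\<lambda>\<gamma>. ?e \<gamma> * monomial \<gamma> (y - a))"
    unfolding sum_distrib_right
  proof (intro ext sum.cong[OF refl])
    fix \<gamma> \<alpha> :: "'a \<Rightarrow> nat" assume "\<alpha> \<in> index_below \<gamma>"
    then have "monomial \<gamma> (y - a) = monomial \<alpha> (y - a) * monomial (\<lambda>k. \<gamma> k - \<alpha> k) (y - a)"
      by (simp add: index_below_def flip: monomial_add)
    then show "c \<alpha> * monomial \<alpha> (y - a) * (d (\<lambda>k. \<gamma> k - \<alpha> k) * monomial (\<lambda>k. \<gamma> k - \<alpha> k) (y - a))
       = c \<alpha> * d (\<lambda>k. \<gamma> k - \<alpha> k) * monomial \<gamma> (y - a)" by simp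
  qed
  finally show "((\<lambda>\<gamma>. ?e \<gamma> * monomial \<gamma> (y - a)) has_sum g y * h y) UNIV" .
qed

text \<open>Summability of \<open>B\<close> makes the family absolutely summable in \<open>l\<close>
  and \<alpha> jointly. At each point of the cube it may then be summed in either order, which
  identifies the sum of the functions with the series of summed coefficients.\<close>

lemma ps_expansion_suminf:
  fixes c :: "nat \<Rightarrow> ('n::finite \<Rightarrow> nat) \<Rightarrow> real"
  assumes "\<And>l. ps_expansion a \<rho> (c l) (B l) (g l)" "summable B" "\<rho> > 0"
  shows "(\<lambda>l. c l \<alpha>) summable_on UNIV"
    and "ps_expansion a \<rho> (\<lambda>\<alpha>. \<Sum>l. c l \<alpha>) (suminf B) (\<lambda>y. \<Sum>l. g l y)"
proof -
  have "\<forall>l. \<exists>S\<le>B l. ((\<lambda>\<alpha>. \<bar>c l \<alpha>\<bar> * \<rho> ^ sum \<alpha> UNIV) has_sum S) UNIV"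
    using assms by (simp add: ps_expansion_def)
  then obtain S where SB: "\<And>l. S l \<le> B l"
    and S: "\<And>l. ((\<lambda>\<alpha>. \<bar>c l \<alpha>\<bar> * \<rho> ^ sum \<alpha> UNIV) has_sum S l) UNIV"
    by metis
  have S0: "0 \<le> S l" for l
    by (rule has_sum_nonneg[OF S]) (use assms(3) in auto)
  have Ssum: "summable S"
    by (rule summable_comparison_test'[OF assms(2), where N = 0]) (use S0 SB in auto)
  then have Son: "S summable_on UNIV"
    using S0 summable_on_UNIV_nonneg_real_iff by blast
  have abs: "(\<lambda>(l, \<alpha>). \<bar>c l \<alpha>\<bar> * \<rho> ^ sum \<alpha> UNIV) summable_on UNIV \<times> UNIV"
    by (rule summable_on_SigmaI[where g = S]) (use S Son assms(3) in auto)
  have abs': "(\<lambda>(\<alpha>, l). \<bar>c l \<alpha>\<bar> * \<rho> ^ sum \<alpha> UNIV) summable_on UNIV \<times> UNIV"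
    using summable_on_swap[THEN iffD1, OF abs] by simp
  have coeff: "(\<lambda>l. \<bar>c l \<alpha>\<bar>) summable_on UNIV" for \<alpha>
    using summable_on_SigmaD1[OF abs', of \<alpha>] assms(3) by (simp add: summable_on_cmult_left')
  have coeff': "(\<lambda>l. c l \<alpha>) summable_on UNIV" for \<alpha>
    using coeff by (subst summable_on_iff_abs_summable_on_real) simp
  then show "(\<lambda>l. c l \<alpha>) summable_on UNIV" .
  have hs: "((\<lambda>l. c l \<alpha>) has_sum (\<Sum>l. c l \<alpha>)) UNIV" for \<alpha>
    using has_sum_imp_sums[OF has_sum_infsum[OF coeff']] has_sum_infsum[OF coeff', of \<alpha>]
    by (simp add: sums_iff)
  show "ps_expansion a \<rho> (\<lambda>\<alpha>. \<Sum>l. c l \<alpha>) (suminf B) (\<lambda>y. \<Sum>l. g l y)"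
    unfolding ps_expansion_def
  proof (intro conjI allI impI)
    have "(S has_sum suminf S) UNIV"
      using has_sum_infsum[OF Son] has_sum_imp_sums[OF has_sum_infsum[OF Son]] by (simp add: sums_iff)
    then have "((\<lambda>(l, \<alpha>). \<bar>c l \<alpha>\<bar> * \<rho> ^ sum \<alpha> UNIV) has_sum suminf S) (UNIV \<times> UNIV)"
      by (intro has_sum_SigmaI[where g = S] abs) (use S in auto)
    then have *: "((\<lambda>(\<alpha>, l). \<bar>c l \<alpha>\<bar> * \<rho> ^ sum \<alpha> UNIV) has_sum suminf S) (UNIV \<times> UNIV)"
      by (subst has_sum_swap) simp
    have "((\<lambda>\<alpha>. (\<Sum>\<^sub>\<infinity>l. \<bar>c l \<alpha>\<bar>) * \<rho> ^ sum \<alpha> UNIV) has_sum suminf S) UNIV"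
      by (rule has_sum_SigmaD[OF *])
         (use has_sum_cmult_left[OF has_sum_infsum[OF coeff]] in auto)
    note st = this
    have le: "\<bar>\<Sum>l. c l \<alpha>\<bar> * \<rho> ^ sum \<alpha> UNIV \<le> (\<Sum>\<^sub>\<infinity>l. \<bar>c l \<alpha>\<bar>) * \<rho> ^ sum \<alpha> UNIV" for \<alpha>
      using assms(3) by (intro mult_right_mono abs_le_of_has_sum[OF hs has_sum_infsum[OF coeff]]) auto
    have "(\<lambda>\<alpha>. \<bar>\<Sum>l. c l \<alpha>\<bar> * \<rho> ^ sum \<alpha> UNIV) summable_on UNIV"
      by (rule summable_on_comparison_test[OF has_sum_imp_summable[OF st]]) (use le assms(3) in auto)
    then obtain R where R: "((\<lambda>\<alpha>. \<bar>\<Sum>l. c l \<alpha>\<bar> * \<rho> ^ sum \<alpha> UNIV) has_sum R) UNIV"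
      by (auto simp: summable_on_def)
    have "R \<le> suminf S" by (rule has_sum_mono[OF R st]) (rule le)
    also have "\<dots> \<le> suminf B" by (intro suminf_le SB Ssum assms)
    finally show "\<exists>S\<le>suminf B. ((\<lambda>\<alpha>. \<bar>\<Sum>l. c l \<alpha>\<bar> * \<rho> ^ sum \<alpha> UNIV) has_sum S) UNIV"
      using R by blast
  next
    fix y assume y: "\<forall>k. \<bar>y $ k - a $ k\<bar> \<le> \<rho>"
    have "(\<lambda>z. norm (case z of (\<alpha>, l) \<Rightarrow> c l \<alpha> * monomial \<alpha> (y - a))) summable_on UNIV \<times> UNIV"
      by (rule summable_on_comparison_test[OF abs'])
         (use y in \<open>auto simp: abs_mult intro!: mult_left_mono abs_monomial_le\<close>)
    then have sm: "(\<lambda>(\<alpha>, l). c l \<alpha> * monomial \<alpha> (y - a)) summable_on UNIV \<times> UNIV"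
      using summable_on_iff_abs_summable_on_real by blast
    have gl: "((\<lambda>\<alpha>. c l \<alpha> * monomial \<alpha> (y - a)) has_sum g l y) UNIV" for l
      using ps_expansion_has_sum[OF assms(1)] y by blast
    from sm obtain G where G: "((\<lambda>(\<alpha>, l). c l \<alpha> * monomial \<alpha> (y - a)) has_sum G) (UNIV \<times> UNIV)"
      by (auto simp: summable_on_def)
    then have "((\<lambda>(l, \<alpha>). c l \<alpha> * monomial \<alpha> (y - a)) has_sum G) (UNIV \<times> UNIV)"
      by (subst has_sum_swap) simp
    then have "((\<lambda>l. g l y) has_sum G) UNIV"
      by (rule has_sum_SigmaD) (use gl in auto)
    then have "G = (\<Sum>l. g l y)"
      using has_sum_imp_sums sums_unique by blast
    moreover have "((\<lambda>\<alpha>. (\<Sum>l. c l \<alpha>) * monomial \<alpha> (y - a)) has_sum G) UNIV"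
      by (rule has_sum_SigmaD[OF G]) (use has_sum_cmult_left[OF hs] in auto)
    ultimately show "((\<lambda>\<alpha>. (\<Sum>l. c l \<alpha>) * monomial \<alpha> (y - a)) has_sum (\<Sum>l. g l y)) UNIV"
      by simp
  qed
qed

section \<open>Derivatives and continuity read off from an expansion\<close>

lemma ps_expansion_partial:
  assumes "ps_expansion a \<rho> c B g" "\<rho> > 0"
  shows "((\<lambda>t. g (a + t *\<^sub>R axis k 1)) has_real_derivative c (unit_index k 1)) (at 0)"
    and "\<bar>c (unit_index k 1)\<bar> \<le> B / \<rho>"
proof -
  from assms obtain S where
    S: "S \<le> B" "((\<lambda>\<alpha>. \<bar>c \<alpha>\<bar> * \<rho> ^ sum \<alpha> UNIV) has_sum S) UNIV"
    by (auto simp: ps_expansion_def)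
  \<comment> \<open>Cauchy estimate: the left side is one of the nonnegative terms adding up to
    \<open>S\<close>.\<close>
  have "\<bar>c (unit_index k 1)\<bar> * \<rho> \<le> S"
    by (rule has_sum_mono_neutral[OF _ S(2),
          where A = "{unit_index k 1}" and f = "\<lambda>\<alpha>. \<bar>c \<alpha>\<bar> * \<rho> ^ sum \<alpha> UNIV"])
       (use assms(2) in \<open>auto intro!: has_sum_finiteI\<close>)
  then show "\<bar>c (unit_index k 1)\<bar> \<le> B / \<rho>"
    using S(1) assms(2) by (simp add: field_simps)
  let ?d = "\<lambda>m. c (unit_index k m)"
  have sums: "(\<lambda>m. ?d m * t ^ m) sums g (a + t *\<^sub>R axis k 1)" if "\<bar>t\<bar> \<le> \<rho>" for t
  proof -
    let ?y = "a + t *\<^sub>R axis k 1"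
    have "\<bar>?y $ i - a $ i\<bar> \<le> \<rho>" for i
      using that assms(2) by (auto simp: axis_def)
    then have "((\<lambda>\<alpha>. c \<alpha> * monomial \<alpha> (?y - a)) has_sum g ?y) UNIV"
      by (rule ps_expansion_has_sum[OF assms(1)])
    \<comment> \<open>On the line through \<open>a\<close> in direction \<open>k\<close> every
      monomial involving another coordinate vanishes; what remains is a power series in one
      variable.\<close>
    also have "?this \<longleftrightarrow> ((\<lambda>\<alpha>. c \<alpha> * monomial \<alpha> (?y - a)) has_sum g ?y) (range (unit_index k))"
    proof (rule has_sum_cong_neutral)
      fix \<alpha> :: "'a \<Rightarrow> nat" assume "\<alpha> \<in> UNIV - range (unit_index k)"
      then have "\<alpha> \<noteq> unit_index k (\<alpha> k)" by blast
      then obtain i where "i \<noteq> k" "\<alpha> i \<noteq> 0"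
        by (auto simp: unit_index_def fun_eq_iff split: if_splits)
      then have "monomial \<alpha> (?y - a) = 0"
        by (auto simp: monomial_def axis_def intro!: prod_zero bexI[of _ i])
      then show "c \<alpha> * monomial \<alpha> (?y - a) = 0" by simp
    qed auto
    also have "\<dots> \<longleftrightarrow> ((\<lambda>m. ?d m * t ^ m) has_sum g ?y) UNIV"
      by (subst has_sum_reindex) (auto simp: inj_on_def o_def)
    finally show ?thesis by (rule has_sum_imp_sums)
  qed
  have "((\<lambda>t. \<Sum>m. ?d m * t ^ m) has_real_derivative (\<Sum>m. diffs ?d m * 0 ^ m)) (at 0)"
    by (rule termdiffs_strong[where K = \<rho>]) (use sums[of \<rho>] assms(2) in \<open>auto simp: sums_iff\<close>)
  also have "(\<Sum>m. diffs ?d m * 0 ^ m) = ?d 1"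
    by (simp add: powser_zero diffs_def)
  finally show "((\<lambda>t. g (a + t *\<^sub>R axis k 1)) has_real_derivative ?d 1) (at 0)"
  proof (rule DERIV_cong_ev[THEN iffD1, rotated -1])
    have "eventually (\<lambda>t. \<bar>t\<bar> < \<rho>) (nhds 0)"
      using eventually_nhds_in_open[of "{-\<rho><..<\<rho>}" 0] assms(2) by (simp add: abs_less_iff eventually_mono)
    then show "eventually (\<lambda>t. (\<Sum>m. ?d m * t ^ m) = g (a + t *\<^sub>R axis k 1)) (nhds 0)"
      by eventually_elim (use sums in \<open>auto simp: sums_iff\<close>)
  qed auto
qed

text \<open>Serves the uniqueness of germs, where a competing solution must be followed from 0 to
  nearby points. Shrinking the cube by a factor \<delta> \<le> 1 gains at least one factor \<delta>
  in every nonconstant monomial.\<close>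

lemma ps_expansion_tendsto:
  assumes "ps_expansion a \<rho> c B g" "\<rho> > 0"
  shows "(g \<longlongrightarrow> g a) (nhds a)"
proof (rule tendstoI)
  fix \<epsilon> :: real assume "\<epsilon> > 0"
  from assms obtain S where
    S: "S \<le> B" "((\<lambda>\<alpha>. \<bar>c \<alpha>\<bar> * \<rho> ^ sum \<alpha> UNIV) has_sum S) UNIV"
    by (auto simp: ps_expansion_def)
  have S0: "0 \<le> S" by (rule has_sum_nonneg[OF S(2)]) (use assms(2) in auto)
  define \<delta> where "\<delta> = min 1 (\<epsilon> / (2 * (S + 1)))"
  have \<delta>: "0 < \<delta>" "\<delta> \<le> 1" "S * \<delta> < \<epsilon>"
  proof -
    show "0 < \<delta>" "\<delta> \<le> 1" using S0 \<open>\<epsilon> > 0\<close> by (auto simp: \<delta>_def)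
    have "S * \<delta> \<le> S * (\<epsilon> / (2 * (S + 1)))" using S0 by (intro mult_left_mono) (auto simp: \<delta>_def)
    also have "\<dots> < \<epsilon>" using S0 \<open>\<epsilon> > 0\<close> by (simp add: field_simps add_nonneg_pos)
    finally show "S * \<delta> < \<epsilon>" .
  qed
  have "dist (g y) (g a) < \<epsilon>" if y: "dist y a < \<delta> * \<rho>" for y
  proof -
    have yk: "\<bar>(y - a) $ k\<bar> \<le> \<delta> * \<rho>" for k
      using component_le_norm_cart[of "y - a" k] y by (simp add: dist_norm)
    also have "\<delta> * \<rho> \<le> \<rho>" using \<delta> assms(2) by simp
    finally have yk': "\<bar>y $ k - a $ k\<bar> \<le> \<rho>" for k by simp
    have "((\<lambda>\<alpha>. c \<alpha> * monomial \<alpha> (y - a) - c \<alpha> * monomial \<alpha> (a - a)) has_sum g y - g a) UNIV"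
      using has_sum_add[OF ps_expansion_has_sum[OF assms(1) yk']
          has_sum_uminusI[OF ps_expansion_has_sum[OF assms(1), of a]]] assms(2) by simp
    then have "\<bar>g y - g a\<bar> \<le> S * \<delta>"
    proof (rule abs_le_of_has_sum[OF _ has_sum_cmult_left[OF S(2)]])
      fix \<alpha> :: "'a \<Rightarrow> nat"
      have "\<bar>monomial \<alpha> (y - a) - monomial \<alpha> (a - a)\<bar> \<le> \<delta> * \<rho> ^ sum \<alpha> UNIV"
      proof (cases "\<alpha> = (\<lambda>_. 0)")
        case True
        then show ?thesis using \<delta> assms(2) by simp
      next
        case False
        then obtain i where i: "\<alpha> i \<noteq> 0" by auto
        then have "monomial \<alpha> (a - a) = 0"
          by (auto simp: monomial_def intro!: prod_zero bexI[of _ i])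
        moreover have "\<bar>monomial \<alpha> (y - a)\<bar> \<le> (\<delta> * \<rho>) ^ sum \<alpha> UNIV"
          by (rule abs_monomial_le[OF yk])
        moreover have "\<delta> ^ sum \<alpha> UNIV \<le> \<delta> ^ 1"
        proof (rule power_decreasing)
          have "\<alpha> i \<le> sum \<alpha> UNIV" by (rule member_le_sum) auto
          with i show "1 \<le> sum \<alpha> UNIV" by linarith
        qed (use \<delta> in auto)
        moreover have "\<delta> ^ sum \<alpha> UNIV * \<rho> ^ sum \<alpha> UNIV \<le> \<delta> ^ 1 * \<rho> ^ sum \<alpha> UNIV"
          using calculation(3) assms(2) by (intro mult_right_mono) auto
        ultimately show ?thesis by (simp add: power_mult_distrib)
      qed
      from mult_left_mono[OF this, of "\<bar>c \<alpha>\<bar>"]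
      show "\<bar>c \<alpha> * monomial \<alpha> (y - a) - c \<alpha> * monomial \<alpha> (a - a)\<bar> \<le> \<bar>c \<alpha>\<bar> * \<rho> ^ sum \<alpha> UNIV * \<delta>"
        by (simp add: abs_mult mult_ac flip: right_diff_distrib)
    qed
    with \<delta>(3) show ?thesis by (simp add: dist_real_def)
  qed
  moreover have "0 < \<delta> * \<rho>" using \<delta> assms by simp
  ultimately show "\<forall>\<^sub>F y in nhds a. dist (g y) (g a) < \<epsilon>"
    unfolding eventually_nhds_metric by blast
qed

section \<open>Passage between expansions and \<open>real_analytic_on\<close>\<close>

lemma real_analytic_onI:
  assumes "open U" "\<And>a. a \<in> U \<Longrightarrow> \<exists>\<rho>>0. \<exists>c B. ps_expansion a \<rho> c B g"
  shows "real_analytic_on g U"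
  unfolding real_analytic_on_def
proof (intro conjI ballI assms(1))
  fix a assume "a \<in> U"
  from assms(2)[OF this] obtain \<rho> c B where \<rho>: "\<rho> > 0" "ps_expansion a \<rho> c B g" by blast
  have "((\<lambda>\<alpha>. c \<alpha> * (\<Prod>k\<in>UNIV. (y $ k - a $ k) ^ \<alpha> k)) has_sum g y) UNIV" if "y \<in> ball a \<rho>" for y
  proof -
    have "\<bar>y $ k - a $ k\<bar> \<le> \<rho>" for k
      using component_le_norm_cart[of "y - a" k] that by (simp add: dist_norm norm_minus_commute)
    from ps_expansion_has_sum[OF \<rho>(2) this] show ?thesis by (simp add: monomial_def)
  qed
  with \<rho> show "\<exists>r>0. \<exists>c. \<forall>y\<in>ball a r.
      ((\<lambda>\<alpha>. c \<alpha> * (\<Prod>k\<in>UNIV. (y $ k - a $ k) ^ \<alpha> k)) has_sum g y) UNIV" by blast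
qed

lemma real_analytic_on_ps_expansion:
  fixes a :: "real ^ 'n::finite"
  assumes "real_analytic_on g U" "a \<in> U"
  shows "\<exists>\<rho>>0. \<exists>c B. ps_expansion a \<rho> c B g"
proof -
  from assms obtain r c where r: "r > 0" and c: "\<And>y. y \<in> ball a r \<Longrightarrow>
      ((\<lambda>\<alpha>. c \<alpha> * monomial \<alpha> (y - a)) has_sum g y) UNIV"
    unfolding real_analytic_on_def monomial_def vector_minus_component by meson
  \<comment> \<open>The Euclidean norm is at most the sum of the coordinates' absolute values,
    whence the division by \<open>CARD('n)\<close>; the 2 puts the closed cube strictly inside the
    open ball.\<close>
  define \<rho> where "\<rho> = r / (2 * CARD('n))"
  have \<rho>: "\<rho> > 0" using r by (simp add: \<rho>_def)
  have cube: "y \<in> ball a r" if "\<And>k. \<bar>y $ k - a $ k\<bar> \<le> \<rho>" for y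
  proof -
    have "norm (y - a) \<le> (\<Sum>k\<in>UNIV. \<bar>(y - a) $ k\<bar>)" by (rule norm_le_l1_cart)
    also have "\<dots> \<le> (\<Sum>k\<in>(UNIV::'n set). \<rho>)" by (intro sum_mono) (use that in auto)
    also have "\<dots> < r" using r by (simp add: \<rho>_def)
    finally show ?thesis by (simp add: dist_norm norm_minus_commute)
  qed
  \<comment> \<open>The corner of the cube, where the terms are up to sign those of the absolute sum
    in \<open>ps_expansion\<close>; for real families unconditional summability is absolute.\<close>
  let ?y = "\<chi> k. a $ k + \<rho>"
  have "((\<lambda>\<alpha>. c \<alpha> * monomial \<alpha> (?y - a)) has_sum g ?y) UNIV"
    by (rule c, rule cube) (use \<rho> in auto)
  then have "(\<lambda>\<alpha>. \<bar>c \<alpha> * monomial \<alpha> (?y - a)\<bar>) summable_on UNIV"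
    using summable_on_iff_abs_summable_on_real[THEN iffD1] has_sum_imp_summable
    unfolding real_norm_def by blast
  also have "(\<lambda>\<alpha>. \<bar>c \<alpha> * monomial \<alpha> (?y - a)\<bar>) = (\<lambda>\<alpha>. \<bar>c \<alpha>\<bar> * \<rho> ^ sum \<alpha> UNIV)"
    using \<rho> by (simp add: abs_mult monomial_def power_sum abs_prod power_abs)
  finally have "\<exists>S. ((\<lambda>\<alpha>. \<bar>c \<alpha>\<bar> * \<rho> ^ sum \<alpha> UNIV) has_sum S) UNIV"
    by (simp add: summable_on_def)
  then obtain S where "((\<lambda>\<alpha>. \<bar>c \<alpha>\<bar> * \<rho> ^ sum \<alpha> UNIV) has_sum S) UNIV" ..
  then have "ps_expansion a \<rho> c S g"
    unfolding ps_expansion_def using c cube by blast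
  with \<rho> show ?thesis by blast
qed

section \<open>Power series depending on parameters\<close>

text \<open>Termwise differentiation with no separate control of the series of derivatives: all
  expansions share centre and radius, each derivative is the coefficient at
  \<open>unit_index k 1\<close>, and coefficients of a sum are sums of coefficients.\<close>

lemma ps_expansion_partial_suminf:
  fixes a :: "real ^ 'n::finite"
  assumes "\<And>l. \<exists>c. ps_expansion a \<rho> c (B l) (g l)" "summable B" "\<rho> > 0"
    and D: "\<And>l. ((\<lambda>t. g l (a + t *\<^sub>R axis k 1)) has_real_derivative D l) (at 0)"
  shows "((\<lambda>t. \<Sum>l. g l (a + t *\<^sub>R axis k 1)) has_real_derivative (\<Sum>l. D l)) (at 0)"
proof -
  from assms(1) obtain c where c: "\<And>l. ps_expansion a \<rho> (c l) (B l) (g l)" by metis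
  have "c l (unit_index k 1) = D l" for l
    by (rule DERIV_unique[OF ps_expansion_partial(1)[OF c assms(3)] D])
  then show ?thesis
    using ps_expansion_partial(1)[OF ps_expansion_suminf(2)[OF c assms(2,3)] assms(3), of k] by simp
qed

text \<open>\<open>M\<close> does not depend on \<open>x\<close>, so its weighted norm controls
  \<open>F\<close> uniformly on the cube, and one summability statement about majorants replaces
  those for all \<open>x\<close>.\<close>

definition fps_majorant ::
    "real ^ 'n::finite \<Rightarrow> real \<Rightarrow> (real ^ 'n \<Rightarrow> real fps) \<Rightarrow> real fps \<Rightarrow> bool" where
  "fps_majorant a \<rho> F M \<longleftrightarrow> (\<forall>b. \<exists>c. ps_expansion a \<rho> c (fps_nth M b) (\<lambda>x. fps_nth (F x) b))"

lemma fps_majorantD: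
  "fps_majorant a \<rho> F M \<Longrightarrow> \<exists>c. ps_expansion a \<rho> c (fps_nth M b) (\<lambda>x. fps_nth (F x) b)"
  by (simp add: fps_majorant_def)

lemma fps_majorant_const:
  "(\<And>b. \<bar>fps_nth F b\<bar> \<le> fps_nth M b) \<Longrightarrow> fps_majorant a \<rho> (\<lambda>_. F) M"
  unfolding fps_majorant_def by (blast intro: ps_expansion_mono ps_expansion_const)

lemma fps_majorant_X_power: "fps_majorant a \<rho> (\<lambda>_. fps_X ^ k) (fps_X ^ k)"
  by (rule fps_majorant_const) (simp add: fps_X_power_nth)

lemma ps_expansion_sum:
  assumes "\<And>i. i \<in> I \<Longrightarrow> \<exists>c. ps_expansion a \<rho> c (B i) (g i)" "\<rho> > 0"
  shows "\<exists>c. ps_expansion a \<rho> c (\<Sum>i\<in>I. B i) (\<lambda>x. \<Sum>i\<in>I. g i x)"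
  using assms(1)
proof (induction I rule: infinite_finite_induct)
  case (insert i I)
  then obtain c d where "ps_expansion a \<rho> c (B i) (g i)"
    "ps_expansion a \<rho> d (\<Sum>i\<in>I. B i) (\<lambda>x. \<Sum>i\<in>I. g i x)" by blast
  from ps_expansion_add[OF this assms(2)] insert show ?case by auto
qed (use ps_expansion_zero[of 0 a \<rho>] in auto)

lemma fps_majorant_sum:
  assumes "\<And>i. i \<in> I \<Longrightarrow> fps_majorant a \<rho> (F i) (M i)" "\<rho> > 0"
  shows "fps_majorant a \<rho> (\<lambda>x. \<Sum>i\<in>I. F i x) (\<Sum>i\<in>I. M i)"
  using assms unfolding fps_majorant_def fps_sum_nth by (intro allI ps_expansion_sum) auto

lemma fps_majorant_mult:
  assumes "fps_majorant a \<rho> F M" "fps_majorant a \<rho> G N" "\<rho> > 0"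
  shows "fps_majorant a \<rho> (\<lambda>x. F x * G x) (M * N)"
  unfolding fps_majorant_def fps_mult_nth
proof (intro allI ps_expansion_sum assms(3))
  fix b i
  from assms(1,2) obtain c d where "ps_expansion a \<rho> c (fps_nth M i) (\<lambda>x. fps_nth (F x) i)"
    "ps_expansion a \<rho> d (fps_nth N (b - i)) (\<lambda>x. fps_nth (G x) (b - i))"
    unfolding fps_majorant_def by blast
  from ps_expansion_mult[OF this assms(3)]
  show "\<exists>c. ps_expansion a \<rho> c (fps_nth M i * fps_nth N (b - i)) (\<lambda>x. fps_nth (F x) i * fps_nth (G x) (b - i))"
    by blast
qed

lemma fps_majorant_power:
  assumes "fps_majorant a \<rho> F M" "\<rho> > 0"
  shows "fps_majorant a \<rho> (\<lambda>x. F x ^ l) (M ^ l)"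
  by (induction l) (use assms fps_majorant_X_power[of a \<rho> 0] in \<open>auto intro: fps_majorant_mult\<close>)

lemma fps_majorant_shift:
  "fps_majorant a \<rho> F M \<Longrightarrow> fps_majorant a \<rho> (\<lambda>x. fps_shift n (F x)) (fps_shift n M)"
  by (simp add: fps_majorant_def)

lemma fps_majorant_suminf:
  assumes "\<And>l. fps_majorant a \<rho> (F l) (M l)" "\<And>b. summable (\<lambda>l. fps_nth (M l) b)" "\<rho> > 0"
  shows "fps_majorant a \<rho> (\<lambda>x. Abs_fps (\<lambda>b. \<Sum>l. fps_nth (F l x) b)) (Abs_fps (\<lambda>b. \<Sum>l. fps_nth (M l) b))"
  unfolding fps_majorant_def
proof
  fix b
  have "\<forall>l. \<exists>c. ps_expansion a \<rho> c (fps_nth (M l) b) (\<lambda>x. fps_nth (F l x) b)"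
    using fps_majorantD[OF assms(1)] by blast
  from choice[OF this]
  obtain c where "\<forall>l. ps_expansion a \<rho> (c l) (fps_nth (M l) b) (\<lambda>x. fps_nth (F l x) b)" ..
  from ps_expansion_suminf(2)[OF this[rule_format] assms(2,3)]
  show "\<exists>c. ps_expansion a \<rho> c (fps_nth (Abs_fps (\<lambda>b. \<Sum>l. fps_nth (M l) b)) b)
      (\<lambda>x. fps_nth (Abs_fps (\<lambda>b. \<Sum>l. fps_nth (F l x) b)) b)" by auto
qed

lemma fps_majorant_wdiv_iter:
  assumes "fps_majorant a \<rho> w M" "fps_majorant a \<rho> g N" "\<rho> > 0"
  shows "fps_majorant a \<rho> (\<lambda>x. wdiv_iter n (w x) (g x) k) (wdiv_iter n M N k)"
  by (induction k) (auto intro!: fps_majorant_mult fps_majorant_shift assms)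

lemma fps_majorant_wdiv:
  assumes "fps_majorant a \<rho> w M" "fps_majorant a \<rho> g N" "\<rho> > 0"
    and summable: "\<And>b. summable (\<lambda>k. fps_nth (wdiv_iter n M N k) b)"
  shows "fps_majorant a \<rho> (\<lambda>x. wdiv_quot n (w x) (g x)) (wdiv_quot n M N)"
    and "fps_majorant a \<rho> (\<lambda>x. wdiv_rem n (w x) (g x)) (wdiv_rem n M N)"
proof -
  note it = fps_majorant_suminf[OF fps_majorant_wdiv_iter[OF assms(1-3)] summable assms(3)]
  show "fps_majorant a \<rho> (\<lambda>x. wdiv_quot n (w x) (g x)) (wdiv_quot n M N)"
    using it unfolding wdiv_quot_def fps_majorant_def by simp
  show "fps_majorant a \<rho> (\<lambda>x. wdiv_rem n (w x) (g x)) (wdiv_rem n M N)"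
    unfolding fps_majorant_def
  proof
    fix b
    show "\<exists>c. ps_expansion a \<rho> c (fps_nth (wdiv_rem n M N) b) (\<lambda>x. fps_nth (wdiv_rem n (w x) (g x)) b)"
    proof (cases "b < n")
      case True
      then show ?thesis using fps_majorantD[OF it, of b] by (simp add: wdiv_rem_def)
    next
      case False
      then show ?thesis using ps_expansion_zero[of 0 a \<rho>] by (auto simp: wdiv_rem_def)
    qed
  qed
qed

section \<open>Differentiating power series with respect to a parameter\<close>

definition has_fps_partial ::
    "'n::finite \<Rightarrow> (real ^ 'n \<Rightarrow> real fps) \<Rightarrow> real fps \<Rightarrow> real ^ 'n \<Rightarrow> bool" where
  "has_fps_partial k F D a \<longleftrightarrow>
     (\<forall>b. ((\<lambda>t. fps_nth (F (a + t *\<^sub>R axis k 1)) b) has_real_derivative fps_nth D b) (at 0))"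

lemma has_fps_partial_partial_deriv:
  "has_fps_partial k F D a \<Longrightarrow> partial_deriv k (\<lambda>x. fps_nth (F x) b) a = fps_nth D b"
  unfolding has_fps_partial_def partial_deriv_def by (blast intro: DERIV_imp_deriv)

text \<open>The Cauchy estimate applied to every coefficient. Coefficientwise differentiability
  alone says nothing about the norm of \<open>D\<close>, and the uniqueness of Weierstrass quotients
  will be applied to a series built from such derivatives.\<close>

lemma fps_majorant_has_fps_partial:
  assumes "fps_majorant a \<rho> F M" "fps_norm_le K M B" "\<rho> > 0" "K > 0"
  shows "\<exists>D. has_fps_partial k F D a \<and> fps_norm_le K D (B / \<rho>)"
proof -
  from assms(1) obtain c where c: "\<And>b. ps_expansion a \<rho> (c b) (fps_nth M b) (\<lambda>x. fps_nth (F x) b)"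
    unfolding fps_majorant_def by metis
  define D where "D = Abs_fps (\<lambda>b. c b (unit_index k 1))"
  have "has_fps_partial k F D a"
    using ps_expansion_partial(1)[OF c assms(3)] by (simp add: has_fps_partial_def D_def)
  moreover have "fps_norm_le K D (B * (1 / \<rho>))"
  proof (rule fps_norm_le_abs_le)
    show "fps_norm_le K (M * fps_const (1 / \<rho>)) (B * (1 / \<rho>))"
      using fps_norm_le_const[of K "1 / \<rho>"] assms by (intro fps_norm_le_mult) auto
    fix b
    have "\<bar>fps_nth D b\<bar> \<le> fps_nth M b / \<rho>"
      using ps_expansion_partial(2)[OF c assms(3)] by (simp add: D_def)
    also have "\<dots> \<le> \<bar>fps_nth (M * fps_const (1 / \<rho>)) b\<bar>"
      using assms(3) by (simp add: divide_right_mono)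
    finally show "\<bar>fps_nth D b\<bar> \<le> \<bar>fps_nth (M * fps_const (1 / \<rho>)) b\<bar>" .
  qed (fact assms(4))
  ultimately show ?thesis by auto
qed

lemma has_fps_partial_const: "has_fps_partial k (\<lambda>_. F) 0 a"
  by (simp add: has_fps_partial_def)

lemma has_fps_partial_add:
  "has_fps_partial k F D a \<Longrightarrow> has_fps_partial k G E a \<Longrightarrow> has_fps_partial k (\<lambda>x. F x + G x) (D + E) a"
  by (auto simp: has_fps_partial_def intro!: DERIV_add)

lemma has_fps_partial_diff:
  "has_fps_partial k F D a \<Longrightarrow> has_fps_partial k G E a \<Longrightarrow> has_fps_partial k (\<lambda>x. F x - G x) (D - E) a"
  by (auto simp: has_fps_partial_def intro!: DERIV_diff)

lemma has_fps_partial_sum: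
  "(\<And>i. i \<in> I \<Longrightarrow> has_fps_partial k (F i) (D i) a) \<Longrightarrow>
     has_fps_partial k (\<lambda>x. \<Sum>i\<in>I. F i x) (\<Sum>i\<in>I. D i) a"
  by (induction I rule: infinite_finite_induct)
     (auto intro: has_fps_partial_const has_fps_partial_add)

lemma has_fps_partial_mult:
  assumes "has_fps_partial k F D a" "has_fps_partial k G E a"
  shows "has_fps_partial k (\<lambda>x. F x * G x) (D * G a + F a * E) a"
  unfolding has_fps_partial_def
proof
  fix b
  let ?y = "\<lambda>t. a + t *\<^sub>R axis k 1"
  have "((\<lambda>t. \<Sum>i=0..b. fps_nth (F (?y t)) i * fps_nth (G (?y t)) (b - i)) has_real_derivative
     (\<Sum>i=0..b. fps_nth D i * fps_nth (G (?y 0)) (b - i) + fps_nth E (b - i) * fps_nth (F (?y 0)) i)) (at 0)"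
    using assms by (intro DERIV_sum DERIV_mult) (auto simp: has_fps_partial_def)
  then show "((\<lambda>t. fps_nth (F (?y t) * G (?y t)) b) has_real_derivative
      fps_nth (D * G a + F a * E) b) (at 0)"
    by (simp add: fps_mult_nth sum.distrib mult.commute[of "fps_nth E _"])
qed

lemma has_fps_partial_cmult:
  assumes "has_fps_partial k F D a"
  shows "has_fps_partial k (\<lambda>x. C * F x) (C * D) a"
  using has_fps_partial_mult[OF has_fps_partial_const[of k C] assms] by simp

lemma has_fps_partial_power:
  assumes "has_fps_partial k F D a"
  shows "has_fps_partial k (\<lambda>x. F x ^ l) (D * (of_nat l * F a ^ (l - 1))) a"
proof (induction l)
  case 0
  then show ?case using has_fps_partial_const[of k 1 a] by simp
next
  case (Suc l)
  have "D * F a ^ l + F a * (D * (of_nat l * F a ^ (l - 1))) = D * (of_nat (Suc l) * F a ^ (Suc l - 1))"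
    by (cases l) (simp_all add: algebra_simps)
  with has_fps_partial_mult[OF assms Suc] show ?case by simp
qed

lemma has_fps_partial_suminf:
  assumes "\<And>l. fps_majorant a \<rho> (F l) (M l)" "\<And>b. summable (\<lambda>l. fps_nth (M l) b)" "\<rho> > 0"
    and "\<And>l. has_fps_partial k (F l) (D l) a"
  shows "has_fps_partial k (\<lambda>x. Abs_fps (\<lambda>b. \<Sum>l. fps_nth (F l x) b)) (Abs_fps (\<lambda>b. \<Sum>l. fps_nth (D l) b)) a"
  unfolding has_fps_partial_def fps_nth_Abs_fps
  using assms(4)
  by (intro allI ps_expansion_partial_suminf[OF fps_majorantD[OF assms(1)] assms(2,3)])
     (simp add: has_fps_partial_def)

text \<open>The series \<open>V(F)\<close>; as \<open>F\<close> may have a constant term this is not a formal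
  composition, and the coefficients are sums of convergent series.\<close>

definition fps_subst :: "real fps \<Rightarrow> real fps \<Rightarrow> real fps" where
  "fps_subst V F = Abs_fps (\<lambda>b. \<Sum>l. fps_nth (fps_const (fps_nth V l) * F ^ l) b)"

lemma fps_subst_norm_le:
  assumes "fps_norm_le K F \<mu>" "summable (\<lambda>l. \<bar>fps_nth V l\<bar> * \<mu> ^ l)" "K > 0"
  shows "fps_norm_le K (fps_subst V F) (\<Sum>l. \<bar>fps_nth V l\<bar> * \<mu> ^ l)"
    and "summable (\<lambda>l. fps_nth (fps_const (fps_nth V l) * F ^ l) b)"
proof -
  have "fps_norm_le K (fps_const (fps_nth V l) * F ^ l) (\<bar>fps_nth V l\<bar> * \<mu> ^ l)" for l
    using assms by (intro fps_norm_le_mult fps_norm_le_const fps_norm_le_power)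
  note * = fps_norm_le_suminf[OF this assms(2,3)]
  show "fps_norm_le K (fps_subst V F) (\<Sum>l. \<bar>fps_nth V l\<bar> * \<mu> ^ l)"
    using *(2) by (simp add: fps_subst_def)
  show "summable (\<lambda>l. fps_nth (fps_const (fps_nth V l) * F ^ l) b)" by (rule *(1))
qed

lemma fps_majorant_subst_term:
  assumes "fps_majorant a \<rho> F M" "\<rho> > 0"
  shows "fps_majorant a \<rho> (\<lambda>x. fps_const (fps_nth V l) * F x ^ l) (fps_const \<bar>fps_nth V l\<bar> * M ^ l)"
proof (rule fps_majorant_mult[OF _ fps_majorant_power[OF assms] assms(2)])
  show "fps_majorant a \<rho> (\<lambda>_. fps_const (fps_nth V l)) (fps_const \<bar>fps_nth V l\<bar>)"
    by (rule fps_majorant_const) (simp add: fps_nth_fps_const)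
qed

lemma fps_majorant_subst_summable:
  assumes "fps_norm_le K M \<mu>" "summable (\<lambda>l. \<bar>fps_nth V l\<bar> * \<mu> ^ l)" "K > 0"
  shows "summable (\<lambda>l. fps_nth (fps_const \<bar>fps_nth V l\<bar> * M ^ l) b)"
proof -
  let ?V = "Abs_fps (\<lambda>l. \<bar>fps_nth V l\<bar>)"
  have "summable (\<lambda>l. fps_nth (fps_const (fps_nth ?V l) * M ^ l) b)"
    by (rule fps_subst_norm_le(2)[OF assms(1) _ assms(3)]) (simp add: assms(2))
  then show ?thesis by (simp only: fps_nth_Abs_fps)
qed

lemma fps_majorant_subst:
  assumes "fps_majorant a \<rho> F M" "\<rho> > 0" "fps_norm_le K M \<mu>"
    "summable (\<lambda>l. \<bar>fps_nth V l\<bar> * \<mu> ^ l)" "K > 0"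
  shows "fps_majorant a \<rho> (\<lambda>x. fps_subst V (F x)) (fps_subst (Abs_fps (\<lambda>l. \<bar>fps_nth V l\<bar>)) M)"
proof -
  have "fps_majorant a \<rho> (\<lambda>x. Abs_fps (\<lambda>b. \<Sum>l. fps_nth (fps_const (fps_nth V l) * F x ^ l) b))
      (Abs_fps (\<lambda>b. \<Sum>l. fps_nth (fps_const \<bar>fps_nth V l\<bar> * M ^ l) b))"
    by (rule fps_majorant_suminf[OF fps_majorant_subst_term[OF assms(1,2)]
          fps_majorant_subst_summable[OF assms(3-5)] assms(2)])
  then show ?thesis by (simp only: fps_subst_def fps_nth_Abs_fps)
qed

text \<open>Chain rule with a monomial as inner derivative. The second factor is V'(F) and involves
  neither the direction \<open>k\<close> nor the exponent \<open>d\<close>; this common factor is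
  the source of the PDEs.\<close>

lemma has_fps_partial_subst:
  assumes "fps_majorant a \<rho> F M" "\<rho> > 0" "fps_norm_le K M \<mu>"
    "summable (\<lambda>l. \<bar>fps_nth V l\<bar> * \<mu> ^ l)" "K > 0" "has_fps_partial k F (fps_X ^ d) a"
  shows "has_fps_partial k (\<lambda>x. fps_subst V (F x))
    (fps_X ^ d * Abs_fps (\<lambda>b. \<Sum>l. fps_nth (fps_const (fps_nth V l) * (of_nat l * F a ^ (l - 1))) b)) a"
proof -
  have term_partial: "has_fps_partial k (\<lambda>x. fps_const (fps_nth V l) * F x ^ l)
     (fps_X ^ d * (fps_const (fps_nth V l) * (of_nat l * F a ^ (l - 1)))) a" for l
    using has_fps_partial_mult[OF has_fps_partial_const has_fps_partial_power[OF assms(6)],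
        of "fps_const (fps_nth V l)" l] by (simp add: mult_ac)
  have "has_fps_partial k (\<lambda>x. fps_subst V (F x))
    (Abs_fps (\<lambda>b. \<Sum>l. fps_nth (fps_X ^ d * (fps_const (fps_nth V l) * (of_nat l * F a ^ (l - 1)))) b)) a"
    unfolding fps_subst_def
    by (rule has_fps_partial_suminf[OF fps_majorant_subst_term[OF assms(1,2)]
          fps_majorant_subst_summable[OF assms(3-5)] assms(2) term_partial])
  \<comment> \<open>Multiplication by a power of X only moves coefficients, so it leaves the
    infinite sum without any estimate.\<close>
  also have "Abs_fps (\<lambda>b. \<Sum>l. fps_nth (fps_X ^ d * (fps_const (fps_nth V l) * (of_nat l * F a ^ (l - 1)))) b)
    = fps_X ^ d * Abs_fps (\<lambda>b. \<Sum>l. fps_nth (fps_const (fps_nth V l) * (of_nat l * F a ^ (l - 1))) b)"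
    by (rule fps_ext) (simp add: fps_X_power_mult_nth)
  finally show ?thesis .
qed

section \<open>Power series in a matrix\<close>

lemma scaleR_matrix_mult_left: "(r *\<^sub>R A) ** B = r *\<^sub>R (A ** (B :: real ^ 'p ^ 'm))"
  by (simp add: vec_eq_iff matrix_matrix_mult_def sum_distrib_left mult.assoc)

lemma scaleR_matrix_mult_right: "A ** (r *\<^sub>R B) = r *\<^sub>R (A ** (B :: real ^ 'p ^ 'm))"
  by (simp add: vec_eq_iff matrix_matrix_mult_def sum_distrib_left mult.left_commute)

lemma matrix_mult_add_left: "(A + C) ** B = A ** B + C ** (B :: real ^ 'p ^ 'm)"
  by (simp add: vec_eq_iff matrix_matrix_mult_def distrib_right sum.distrib)

lemma matrix_mult_diff_right: "B ** (A - C) = B ** A - B ** (C :: real ^ 'p ^ 'm)"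
  by (simp add: vec_eq_iff matrix_matrix_mult_def right_diff_distrib sum_subtractf)

lemma bounded_linear_matrix_mult_left: "bounded_linear (\<lambda>X. A ** (X :: real ^ 'p ^ 'm))"
  unfolding linear_conv_bounded_linear[symmetric]
  by (rule linearI) (simp_all add: matrix_add_ldistrib scaleR_matrix_mult_right)

lemma bounded_linear_matrix_mult_right: "bounded_linear (\<lambda>X. (X :: real ^ 'm ^ 'k) ** A)"
  unfolding linear_conv_bounded_linear[symmetric]
  by (rule linearI) (simp_all add: matrix_mult_add_left scaleR_matrix_mult_left)

lemma matpow_add: "matpow A (k + l) = matpow A k ** matpow A l"
  by (induction k) (simp_all add: matrix_mul_assoc)

section \<open>Cayley-Hamilton theorem and growth of matrix powers\<close>

lemma poly_det: "poly (det M) (l :: real) = det (\<chi> i j. poly (M $ i $ j) l)"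
  by (simp add: det_def poly_sum poly_prod)

text \<open>The \<open>B j m\<close> are the entries of the adjugate of X Id - L, written as Cramer
  determinants. Comparing coefficients of X^k in (X Id - L) adj = q Id and multiplying by L^k from
  the left gives a telescoping sum for q(L).\<close>

lemma has_char_coeffs_cayley_hamilton:
  fixes L :: "real ^ 'n::finite ^ 'n"
  assumes "has_char_coeffs e L c"
  shows "matpow L CARD('n) = (\<Sum>i=1..CARD('n). (c $ e i) *\<^sub>R matpow L (CARD('n) - i))"
proof -
  define P :: "real poly ^ 'n ^ 'n" where
    "P = (\<chi> i j. (if i = j then [:0, 1:] else 0) - [:L $ i $ j:])"
  define B where "B j m = det (\<chi> r s. if s = j then (if r = m then 1 else 0) else P $ r $ s)" for j m
  define q where "q = monom 1 CARD('n) - (\<Sum>i=1..CARD('n). monom (c $ e i) (CARD('n) - i))"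
  have P: "poly (P $ i $ j) l = (mat l - L) $ i $ j" for i j l
    by (simp add: P_def mat_def)
  have q: "poly q l = det (mat l - L)" for l
    using assms by (simp add: has_char_coeffs_def q_def poly_monom poly_sum)
  have "coeff (\<Sum>i=1..CARD('n). monom (c $ e i) (CARD('n) - i)) CARD('n) = 0"
    by (auto simp: coeff_sum intro!: sum.neutral)
  then have "coeff q CARD('n) = 1" by (simp add: q_def)
  then have "q \<noteq> 0" by auto
  have adj: "(\<Sum>j\<in>UNIV. P $ i $ j * B j m) = (if i = m then q else 0)" for i m
  proof -
    let ?Q = "(\<Sum>j\<in>UNIV. P $ i $ j * B j m) - (if i = m then q else 0)"
    \<comment> \<open>Cramer's rule covers only the points where \<open>q\<close> is nonzero. The
      extra factor \<open>q\<close> takes care of its roots and is cancelled afterwards.\<close>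
    have "poly (?Q * q) l = 0" for l
    proof (cases "poly q l = 0")
      case False
      let ?A = "mat l - L"
      have d0: "det ?A \<noteq> 0" using False q by simp
      have Bl: "poly (B k m) l = det (\<chi> r s. if s = k then axis m 1 $ r else ?A $ r $ s)" for k
        unfolding B_def poly_det by (rule arg_cong[of _ _ det]) (auto simp: vec_eq_iff P axis_def)
      have "?A *v (\<chi> k. poly (B k m) l / det ?A) = axis m 1"
        unfolding cramer[OF d0] Bl ..
      then have "(\<Sum>j\<in>UNIV. ?A $ i $ j * (poly (B j m) l / det ?A)) = (if i = m then 1 else 0)"
        unfolding matrix_vector_mult_def by (auto simp: vec_eq_iff axis_def)
      then have "(\<Sum>j\<in>UNIV. ?A $ i $ j * poly (B j m) l) = (if i = m then det ?A else 0)"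
        using d0 by (auto simp: field_simps simp flip: sum_divide_distrib split: if_splits)
      then show ?thesis by (simp add: poly_sum P q)
    qed simp
    then have "?Q * q = 0" using poly_all_0_iff_0 by blast
    with \<open>q \<noteq> 0\<close> show ?thesis by simp
  qed
  define Bm where "Bm k = (\<chi> j m. coeff (B j m) k)" for k
  define T where "T k = (if k = 0 then 0 else matpow L k ** Bm (k - 1))" for k
  have coeffs: "coeff q k *\<^sub>R mat 1 = (if k = 0 then 0 else Bm (k - 1)) - L ** Bm k" for k
  proof -
    have "(coeff q k *\<^sub>R (mat 1 :: real ^ 'n ^ 'n)) $ i $ m =
        ((if k = 0 then 0 else Bm (k - 1)) - L ** Bm k) $ i $ m" for i m
    proof -
      have "(coeff q k *\<^sub>R (mat 1 :: real ^ 'n ^ 'n)) $ i $ m = coeff (\<Sum>j\<in>UNIV. P $ i $ j * B j m) k"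
        by (simp add: adj mat_def)
      also have "\<dots> = (\<Sum>j\<in>UNIV. (if j = i then (if k = 0 then 0 else coeff (B j m) (k - 1)) else 0)
           - L $ i $ j * coeff (B j m) k)"
        unfolding coeff_sum
        by (rule sum.cong) (auto simp: P_def algebra_simps coeff_pCons split: nat.splits)
      also have "\<dots> = ((if k = 0 then 0 else Bm (k - 1)) - L ** Bm k) $ i $ m"
        by (simp add: sum_subtractf matrix_matrix_mult_def Bm_def)
      finally show ?thesis .
    qed
    then show ?thesis by (simp add: vec_eq_iff)
  qed
  have step: "coeff q k *\<^sub>R matpow L k = T k - T (Suc k)" for k
  proof -
    have "coeff q k *\<^sub>R matpow L k = matpow L k ** (coeff q k *\<^sub>R mat 1)"
      by (simp add: scaleR_matrix_mult_right)
    also have "\<dots> = T k - matpow L k ** (L ** Bm k)"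
      unfolding coeffs matrix_mult_diff_right by (simp add: T_def matrix_matrix_mult_def vec_eq_iff)
    also have "matpow L k ** (L ** Bm k) = T (Suc k)"
    proof -
      have eq: "matpow L (Suc k) = matpow L k ** L" using matpow_add[of L k 1] by simp
      show ?thesis by (simp add: T_def eq matrix_mul_assoc del: matpow.simps)
    qed
    finally show ?thesis .
  qed
  \<comment> \<open>Beyond all degrees of adjugate entries, so that the upper end of the telescope
    vanishes, and at least \<open>CARD('n)\<close>, so that all monomials of \<open>q\<close> are in
    range.\<close>
  define N where "N = CARD('n) + (\<Sum>j\<in>UNIV. \<Sum>m\<in>UNIV. degree (B j m))"
  have "degree (B j m) < Suc N" for j m
  proof -
    have "degree (B j m) \<le> (\<Sum>m\<in>UNIV. degree (B j m))" by (rule member_le_sum) auto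
    also have "\<dots> \<le> (\<Sum>j\<in>UNIV. \<Sum>m\<in>UNIV. degree (B j m))"
      by (rule member_le_sum[of j UNIV "\<lambda>j. \<Sum>m\<in>UNIV. degree (B j m)"]) auto
    finally show ?thesis by (simp add: N_def)
  qed
  then have "Bm (Suc N) = 0" by (simp add: Bm_def vec_eq_iff coeff_eq_0)
  have "(\<Sum>k<Suc (Suc N). coeff q k *\<^sub>R matpow L k) = T 0 - T (Suc (Suc N))"
    unfolding step by (rule sum_lessThan_telescope')
  also have "\<dots> = 0"
    using \<open>Bm (Suc N) = 0\<close> by (simp add: T_def matrix_matrix_mult_def vec_eq_iff)
  finally have 0: "(\<Sum>k<Suc (Suc N). coeff q k *\<^sub>R matpow L k) = 0" .
  have mono: "(\<Sum>k<Suc (Suc N). coeff (monom a m) k *\<^sub>R matpow L k) = a *\<^sub>R matpow L m" if "m \<le> CARD('n)" for a m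
  proof -
    have "(\<Sum>k<Suc (Suc N). coeff (monom a m) k *\<^sub>R matpow L k)
        = (\<Sum>k<Suc (Suc N). if k = m then a *\<^sub>R matpow L m else 0)"
      by (rule sum.cong) auto
    also have "\<dots> = a *\<^sub>R matpow L m"
      using that by (simp del: sum.lessThan_Suc add: N_def)
    finally show ?thesis .
  qed
  have "(\<Sum>k<Suc (Suc N). coeff q k *\<^sub>R matpow L k) = (\<Sum>k<Suc (Suc N). coeff (monom 1 CARD('n)) k *\<^sub>R matpow L k)
      - (\<Sum>k<Suc (Suc N). \<Sum>i=1..CARD('n). coeff (monom (c $ e i) (CARD('n) - i)) k *\<^sub>R matpow L k)"
    unfolding q_def coeff_diff coeff_sum scaleR_left_diff_distrib sum_subtractf scaleR_left.sum ..
  also have "\<dots> = matpow L CARD('n) - (\<Sum>i=1..CARD('n). (c $ e i) *\<^sub>R matpow L (CARD('n) - i))"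
    by (subst sum.swap) (simp only: mono diff_le_self order_refl scaleR_one)
  finally show ?thesis using 0 by simp
qed

text \<open>Cayley-Hamilton is a linear recurrence of order n for the powers of \<open>L\<close>,
  and the assumption on the coefficients lets the bound pass from n consecutive powers to the next.
  It makes evaluation at \<open>L\<close> bounded on the weighted algebra.\<close>

lemma matpow_bound:
  fixes L :: "real ^ 'n::finite ^ 'n"
  assumes "has_char_coeffs e L c" "K > 0" "(\<Sum>i=1..CARD('n). \<bar>c $ e i\<bar> * K ^ (CARD('n) - i)) \<le> K ^ CARD('n)"
  shows "\<exists>B. \<forall>k. norm (matpow L k) \<le> B * K ^ k"
proof -
  let ?n = "CARD('n)"
  define B where "B = (\<Sum>k<?n. norm (matpow L k) / K ^ k)"
  have B0: "B \<ge> 0" using assms(2) by (auto simp: B_def intro!: sum_nonneg)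
  have "norm (matpow L k) \<le> B * K ^ k" for k
  proof (induction k rule: less_induct)
    case (less k)
    show ?case
    proof (cases "k < ?n")
      case True
      have "norm (matpow L k) / K ^ k \<le> B"
        unfolding B_def using True assms(2)
        by (intro member_le_sum) auto
      then show ?thesis using assms(2) by (simp add: field_simps)
    next
      case False
      then obtain m where k: "k = m + ?n" by (metis le_add_diff_inverse2 not_less)
      have "matpow L k = (\<Sum>i=1..?n. (c $ e i) *\<^sub>R matpow L (m + (?n - i)))"
        unfolding k matpow_add has_char_coeffs_cayley_hamilton[OF assms(1)]
        by (simp add: linear_sum[OF bounded_linear.linear[OF bounded_linear_matrix_mult_left]] scaleR_matrix_mult_right)
      also have "norm \<dots> \<le> (\<Sum>i=1..?n. \<bar>c $ e i\<bar> * (B * K ^ (m + (?n - i))))"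
        by (rule sum_norm_le) (auto intro!: mult_left_mono less simp: k)
      also have "\<dots> = B * K ^ m * (\<Sum>i=1..?n. \<bar>c $ e i\<bar> * K ^ (?n - i))"
        by (simp only: sum_distrib_left power_add mult_ac)
      also have "\<dots> \<le> B * K ^ m * K ^ ?n"
        using assms(2,3) B0 by (intro mult_left_mono) auto
      finally show ?thesis by (simp add: k power_add mult.assoc)
    qed
  qed
  then show ?thesis by blast
qed

lemma gl_regular_lincomb_eq_0:
  fixes L :: "real ^ 'n::finite ^ 'n"
  assumes "gl_regular L" "(\<Sum>k<CARD('n). s k *\<^sub>R matpow L k) = 0" "k < CARD('n)"
  shows "s k = 0"
proof -
  let ?I = "{..<CARD('n)}"
  have inj: "inj_on (matpow L) ?I" and ind: "independent (matpow L ` ?I)"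
    using assms(1) by (auto simp: gl_regular_def)
  have "(\<Sum>v\<in>matpow L ` ?I. s (inv_into ?I (matpow L) v) *\<^sub>R v) = 0"
    using assms(2) by (simp add: sum.reindex[OF inj] inv_into_f_f[OF inj])
  from real_vector.independentD[OF ind _ order_refl this, of "matpow L k"]
  show ?thesis using assms(3) inv_into_f_f[OF inj, of k] by simp
qed

section \<open>Evaluation of power series at a matrix\<close>

definition fps_matrix :: "real ^ 'n::finite ^ 'n \<Rightarrow> real fps \<Rightarrow> real ^ 'n ^ 'n" where
  "fps_matrix L F = (\<Sum>k. fps_nth F k *\<^sub>R matpow L k)"

context
  fixes L :: "real ^ 'n::finite ^ 'n" and K B :: real
  assumes K: "K > 0" and pow: "\<And>k. norm (matpow L k) \<le> B * K ^ k"
begin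

lemma matpow_bound_nonneg: "B \<ge> 0"
  using order_trans[OF norm_ge_zero pow[of 0]] by simp

lemma fps_matrix_norm_summable:
  assumes "fps_norm_le K F C"
  shows "summable (\<lambda>k. norm (fps_nth F k *\<^sub>R matpow L k))"
proof (rule summable_comparison_test')
  show "summable (\<lambda>k. \<bar>fps_nth F k\<bar> * K ^ k * B)"
    by (rule summable_mult2[OF fps_norm_le_summable[OF assms K]])
  show "norm (norm (fps_nth F k *\<^sub>R matpow L k)) \<le> \<bar>fps_nth F k\<bar> * K ^ k * B" for k
    using mult_left_mono[OF pow[of k], of "\<bar>fps_nth F k\<bar>"] by (simp add: mult_ac)
qed

lemma fps_matrix_summable: "fps_norm_le K F C \<Longrightarrow> summable (\<lambda>k. fps_nth F k *\<^sub>R matpow L k)"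
  by (rule summable_norm_cancel[OF fps_matrix_norm_summable])

lemma fps_matrix_sums:
  "fps_norm_le K F C \<Longrightarrow> (\<lambda>k. fps_nth F k *\<^sub>R matpow L k) sums fps_matrix L F"
  unfolding fps_matrix_def by (rule summable_sums[OF fps_matrix_summable])

lemma norm_fps_matrix_le:
  assumes "fps_norm_le K F C"
  shows "norm (fps_matrix L F) \<le> C * B"
proof -
  have sm: "summable (\<lambda>k. \<bar>fps_nth F k\<bar> * K ^ k)" and le: "(\<Sum>k. \<bar>fps_nth F k\<bar> * K ^ k) \<le> C"
    using assms unfolding fps_norm_le_iff_suminf[OF K] by auto
  have "norm (fps_matrix L F) \<le> (\<Sum>k. norm (fps_nth F k *\<^sub>R matpow L k))"
    unfolding fps_matrix_def by (rule summable_norm[OF fps_matrix_norm_summable[OF assms]])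
  also have "\<dots> \<le> (\<Sum>k. \<bar>fps_nth F k\<bar> * K ^ k * B)"
  proof (rule suminf_le[OF _ fps_matrix_norm_summable[OF assms] summable_mult2[OF sm]])
    show "norm (fps_nth F k *\<^sub>R matpow L k) \<le> \<bar>fps_nth F k\<bar> * K ^ k * B" for k
      using mult_left_mono[OF pow[of k], of "\<bar>fps_nth F k\<bar>"] by (simp add: mult_ac)
  qed
  also have "\<dots> = (\<Sum>k. \<bar>fps_nth F k\<bar> * K ^ k) * B"
    by (rule suminf_mult2[OF sm, symmetric])
  also have "\<dots> \<le> C * B" using le matpow_bound_nonneg by (rule mult_right_mono)
  finally show ?thesis .
qed

lemma fps_matrix_diff:
  assumes "fps_norm_le K F C" "fps_norm_le K G D"
  shows "fps_matrix L (F - G) = fps_matrix L F - fps_matrix L G"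
  using sums_diff[OF fps_matrix_sums[OF assms(1)] fps_matrix_sums[OF assms(2)]]
  by (simp add: fps_matrix_def sums_iff scaleR_left_diff_distrib)

lemma fps_matrix_sum:
  assumes "\<And>i. i \<in> I \<Longrightarrow> fps_norm_le K (F i) (C i)"
  shows "fps_matrix L (\<Sum>i\<in>I. F i) = (\<Sum>i\<in>I. fps_matrix L (F i))"
  using sums_sum[of I, OF fps_matrix_sums[OF assms]]
  by (simp add: fps_matrix_def sums_iff fps_sum_nth scaleR_left.sum)

lemma fps_matrix_cmult:
  assumes "fps_norm_le K F C"
  shows "fps_matrix L (fps_const r * F) = r *\<^sub>R fps_matrix L F"
  using sums_scaleR_right[OF fps_matrix_sums[OF assms], of r]
  by (simp add: fps_matrix_def sums_iff)

text \<open>Both orders occur: \<open>mat_r\<close> multiplies by powers of \<open>L\<close> from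
  the right, while \<open>mat_M\<close> will enter as a left factor.\<close>

lemma fps_matrix_X_power_mult:
  assumes "fps_norm_le K F C"
  shows "fps_matrix L (fps_X ^ m * F) = matpow L m ** fps_matrix L F"
    and "fps_matrix L (fps_X ^ m * F) = fps_matrix L F ** matpow L m"
proof -
  have *: "fps_matrix L (fps_X ^ m * F) = S"
    if "(\<lambda>k. fps_nth F k *\<^sub>R matpow L (k + m)) sums S" for S
  proof -
    have "(\<lambda>k. fps_nth (fps_X ^ m * F) (k + m) *\<^sub>R matpow L (k + m)) sums S"
      using that by (simp add: fps_X_power_mult_nth)
    also have "?this \<longleftrightarrow> (\<lambda>k. fps_nth (fps_X ^ m * F) k *\<^sub>R matpow L k) sums S"
      by (rule sums_zero_iff_shift) (simp add: fps_X_power_mult_nth)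
    finally show ?thesis by (simp add: fps_matrix_def sums_iff)
  qed
  show "fps_matrix L (fps_X ^ m * F) = matpow L m ** fps_matrix L F"
    by (rule *) (use bounded_linear.sums[OF bounded_linear_matrix_mult_left fps_matrix_sums[OF assms], of "matpow L m"]
        in \<open>simp add: scaleR_matrix_mult_right add.commute flip: matpow_add\<close>)
  show "fps_matrix L (fps_X ^ m * F) = fps_matrix L F ** matpow L m"
    by (rule *) (use bounded_linear.sums[OF bounded_linear_matrix_mult_right fps_matrix_sums[OF assms], of "matpow L m"]
        in \<open>simp add: scaleR_matrix_mult_left flip: matpow_add\<close>)
qed

lemma fps_matrix_finite:
  assumes "\<And>k. k \<ge> m \<Longrightarrow> fps_nth F k = 0"
  shows "fps_matrix L F = (\<Sum>k<m. fps_nth F k *\<^sub>R matpow L k)"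
  unfolding fps_matrix_def by (rule suminf_finite) (auto simp: assms)

lemma fps_matrix_one: "fps_matrix L 1 = mat 1"
  using fps_matrix_finite[of 1 1] by simp

lemma fps_matrix_X_power: "fps_matrix L (fps_X ^ m) = matpow L m"
  using fps_matrix_X_power_mult(1)[of 1 1 m] fps_norm_le_const[of K 1] by (simp add: fps_matrix_one)

text \<open>Continuity of evaluation: the tail of the series has norm at most the tail of
  \<open>C\<close>.\<close>

lemma fps_matrix_suminf:
  assumes "\<And>l. fps_norm_le K (G l) (C l)" "summable C"
  shows "(\<lambda>l. fps_matrix L (G l)) sums fps_matrix L (Abs_fps (\<lambda>b. \<Sum>l. fps_nth (G l) b))"
    (is "_ sums fps_matrix L ?S")
proof -
  note S = fps_norm_le_suminf[OF assms K]
  have part: "fps_norm_le K (\<Sum>l<N. G l) (\<Sum>l<N. C l)" for N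
    by (rule fps_norm_le_sum[OF assms(1) K])
  have le: "norm (fps_matrix L ?S - (\<Sum>l<N. fps_matrix L (G l))) \<le> (suminf C - (\<Sum>l<N. C l)) * B" for N
  proof -
    have "?S - (\<Sum>l<N. G l) = Abs_fps (\<lambda>b. \<Sum>l. fps_nth (G (l + N)) b)"
      by (rule fps_ext) (simp add: fps_sum_nth suminf_minus_initial_segment[OF S(1)])
    moreover have "fps_norm_le K (Abs_fps (\<lambda>b. \<Sum>l. fps_nth (G (l + N)) b)) (\<Sum>l. C (l + N))"
      by (rule fps_norm_le_suminf(2)[OF assms(1) summable_ignore_initial_segment[OF assms(2)] K])
    ultimately have "fps_norm_le K (?S - (\<Sum>l<N. G l)) (suminf C - (\<Sum>l<N. C l))"
      by (simp add: suminf_minus_initial_segment[OF assms(2)])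
    from norm_fps_matrix_le[OF this] show ?thesis
      by (simp add: fps_matrix_diff[OF S(2) part] fps_matrix_sum[OF assms(1)])
  qed
  have "(\<lambda>N. (suminf C - (\<Sum>l<N. C l)) * B) \<longlonglongrightarrow> (suminf C - suminf C) * B"
    by (intro tendsto_intros summable_LIMSEQ assms)
  then have "(\<lambda>N. (suminf C - (\<Sum>l<N. C l)) * B) \<longlonglongrightarrow> 0" by simp
  then have "(\<lambda>N. fps_matrix L ?S - (\<Sum>l<N. fps_matrix L (G l))) \<longlonglongrightarrow> 0"
    by (rule Lim_null_comparison[rotated]) (simp add: le)
  from tendsto_diff[OF tendsto_const[of "fps_matrix L ?S"] this] show ?thesis
    by (simp add: sums_def)
qed

end

text \<open>For M = 0 each v_i(M) is a scalar matrix, and the relation expresses L^n through lower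
  powers just as Cayley-Hamilton does; regularity makes the two agree. No bound on \<open>c\<close>
  enters, so the value at 0 is forced for every solution.\<close>

lemma matrix_relation_at_0:
  fixes L :: "real ^ 'n::finite ^ 'n"
  assumes "gl_regular L" "has_char_coeffs e L c" "matrix_relation e V 0 L" "i \<in> {1..CARD('n)}"
  shows "c $ e i = fps_nth (V i) 0"
proof -
  let ?n = "CARD('n)"
  have M: "mat_M e 0 L = 0" by (simp add: mat_M_def)
  have mp: "matpow (0 :: real ^ 'n ^ 'n) k = 0" if "k > 0" for k
    using that by (cases k) (simp_all add: vec_eq_iff matrix_matrix_mult_def)
  have "mat_fps F (0 :: real ^ 'n ^ 'n) = fps_nth F 0 *\<^sub>R mat 1" for F
    unfolding mat_fps_def using suminf_finite[of "{0}" "\<lambda>k. fps_nth F k *\<^sub>R matpow (0 :: real ^ 'n ^ 'n) k"] mp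
    by simp
  then have "matpow L ?n = (\<Sum>i=1..?n. fps_nth (V i) 0 *\<^sub>R matpow L (?n - i))"
    using assms(3) by (simp add: matrix_relation_def M mat_r_def scaleR_matrix_mult_left)
  with has_char_coeffs_cayley_hamilton[OF assms(2)]
  have "(\<Sum>i=1..?n. (c $ e i - fps_nth (V i) 0) *\<^sub>R matpow L (?n - i)) = 0"
    by (simp add: scaleR_left_diff_distrib sum_subtractf)
  also have "(\<Sum>i=1..?n. (c $ e i - fps_nth (V i) 0) *\<^sub>R matpow L (?n - i))
      = (\<Sum>k<?n. (c $ e (?n - k) - fps_nth (V (?n - k)) 0) *\<^sub>R matpow L k)"
    by (rule sum.reindex_bij_witness[where i = "\<lambda>k. ?n - k" and j = "\<lambda>i. ?n - i"]) auto
  finally show ?thesis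
    using gl_regular_lincomb_eq_0[OF assms(1), of "\<lambda>k. c $ e (?n - k) - fps_nth (V (?n - k)) 0" "?n - i"] assms(4)
    by auto
qed

section \<open>The Weierstrass polynomial of the family\<close>

text \<open>If m_x has norm at most t, these series bound the norm of v_i(m_x). Their limit shows
  that the values v_i(0) alone decide how large \<open>K\<close> must be.\<close>

lemma fps_abs_power_series_at_0:
  assumes "fps_conv_radius (F :: real fps) > 0"
  shows "\<forall>\<^sub>F t in at_right 0. summable (\<lambda>l. \<bar>fps_nth F l\<bar> * t ^ l)"
    and "((\<lambda>t. \<Sum>l. \<bar>fps_nth F l\<bar> * t ^ l) \<longlongrightarrow> \<bar>fps_nth F 0\<bar>) (at_right 0)"
proof -
  from assms obtain r where r: "0 < ereal r" "ereal r < fps_conv_radius F"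
    using ereal_dense2[OF assms] by blast
  then have "r > 0" by simp
  have sm: "summable (\<lambda>l. \<bar>fps_nth F l\<bar> * t ^ l)" if "0 \<le> t" "t \<le> r" for t
  proof -
    have "ereal (norm t) < fps_conv_radius F"
      using that r(2) by (simp add: order.strict_trans1[of _ "ereal r"])
    from norm_summable_fps[OF this] show ?thesis
      using that by (simp add: abs_mult power_abs)
  qed
  show "\<forall>\<^sub>F t in at_right 0. summable (\<lambda>l. \<bar>fps_nth F l\<bar> * t ^ l)"
    unfolding eventually_at_right_field using sm \<open>r > 0\<close> by (intro exI[of _ r]) auto
  have "isCont (\<lambda>t. \<Sum>l. \<bar>fps_nth F l\<bar> * t ^ l) 0"
    by (rule isCont_powser[where K = r]) (use sm[of r] \<open>r > 0\<close> in auto)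
  then have "((\<lambda>t. \<Sum>l. \<bar>fps_nth F l\<bar> * t ^ l) \<longlongrightarrow> \<bar>fps_nth F 0\<bar>) (at 0)"
    by (simp add: isCont_def powser_zero)
  then show "((\<lambda>t. \<Sum>l. \<bar>fps_nth F l\<bar> * t ^ l) \<longlongrightarrow> \<bar>fps_nth F 0\<bar>) (at_right 0)"
    by (rule filterlim_mono) (auto simp: at_within_le_at)
qed

text \<open>The parameters range over the open cube of half-side \<epsilon>; \<mu> bounds the norm
  of m_x there, and \<open>small\<close> is the resulting bound K^n/3 for w_x.\<close>

locale weierstrass_family =
  fixes e :: "nat \<Rightarrow> 'n::finite" and V :: "nat \<Rightarrow> real fps" and K \<epsilon> \<mu> :: real
  assumes enum: "bij_betw e {1..CARD('n)} UNIV" and K: "K > 0" and eps: "\<epsilon> > 0"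
    and mu: "\<mu> = \<epsilon> * (\<Sum>j=1..CARD('n). K ^ (CARD('n) - j))"
    and conv: "\<And>i. i \<in> {1..CARD('n)} \<Longrightarrow> summable (\<lambda>l. \<bar>fps_nth (V i) l\<bar> * \<mu> ^ l)"
    and small: "(\<Sum>i=1..CARD('n). K ^ (CARD('n) - i) * (\<Sum>l. \<bar>fps_nth (V i) l\<bar> * \<mu> ^ l)) \<le> 1 / 3 * K ^ CARD('n)"
begin

text \<open>Plays two roles: \<open>lowpoly x\<close> is m_x, and for a vector \<open>c\<close> of
  characteristic coefficients X^n - \<open>lowpoly c\<close> is the characteristic
  polynomial.\<close>

definition lowpoly :: "real ^ 'n \<Rightarrow> real fps" where
  "lowpoly c = (\<Sum>i=1..CARD('n). fps_const (c $ e i) * fps_X ^ (CARD('n) - i))"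

definition wser :: "real ^ 'n \<Rightarrow> real fps" where
  "wser x = (\<Sum>i=1..CARD('n). fps_X ^ (CARD('n) - i) * fps_subst (V i) (lowpoly x))"

definition lowpoly_maj :: "real fps" where
  "lowpoly_maj = lowpoly (\<chi> k. \<epsilon>)"

definition wser_maj :: "real fps" where
  "wser_maj = (\<Sum>i=1..CARD('n). fps_X ^ (CARD('n) - i) * fps_subst (Abs_fps (\<lambda>l. \<bar>fps_nth (V i) l\<bar>)) lowpoly_maj)"

text \<open>Dividing X^n by r_x gives X^n = q r_x + s with s of degree below n, so p_x is X^n - s
  and the remainder holds the f_i with their signs.\<close>

definition quot :: "real ^ 'n \<Rightarrow> real fps" where
  "quot x = wdiv_quot CARD('n) (wser x) (fps_X ^ CARD('n))"

definition remd :: "real ^ 'n \<Rightarrow> real fps" where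
  "remd x = wdiv_rem CARD('n) (wser x) (fps_X ^ CARD('n))"

definition sol :: "real ^ 'n \<Rightarrow> real ^ 'n" where
  "sol x = (\<chi> k. fps_nth (remd x) (CARD('n) - inv_into {1..CARD('n)} e k))"

lemma inj_e: "i \<in> {1..CARD('n)} \<Longrightarrow> j \<in> {1..CARD('n)} \<Longrightarrow> e i = e j \<longleftrightarrow> i = j"
  using inj_on_eq_iff[OF bij_betw_imp_inj_on[OF enum]] by blast

lemma ex_e: "\<exists>i\<in>{1..CARD('n)}. k = e i"
  using bij_betw_imp_surj_on[OF enum] by (metis UNIV_I imageE)

lemma inv_e: "i \<in> {1..CARD('n)} \<Longrightarrow> inv_into {1..CARD('n)} e (e i) = i"
  by (rule inv_into_f_f[OF bij_betw_imp_inj_on[OF enum]])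

lemma sol_nth: "i \<in> {1..CARD('n)} \<Longrightarrow> sol x $ e i = fps_nth (remd x) (CARD('n) - i)"
  by (simp only: sol_def vec_lambda_beta inv_e)

lemma lowpoly_nth: "fps_nth (lowpoly c) b = (if b < CARD('n) then c $ e (CARD('n) - b) else 0)"
proof -
  have "fps_nth (lowpoly c) b = (\<Sum>i=1..CARD('n). if i = CARD('n) - b \<and> b < CARD('n) then c $ e i else 0)"
    unfolding lowpoly_def fps_sum_nth by (rule sum.cong) (auto simp: fps_X_power_nth)
  then show ?thesis by auto
qed

lemma lowpoly_inject: "lowpoly c = lowpoly d \<Longrightarrow> c = d"
proof (rule vec_eq_iff[THEN iffD2], rule)
  fix k assume eq: "lowpoly c = lowpoly d"
  obtain i where "i \<in> {1..CARD('n)}" "k = e i" using ex_e by blast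
  with arg_cong[OF eq, of "\<lambda>F. fps_nth F (CARD('n) - i)"] show "c $ k = d $ k"
    by (simp add: lowpoly_nth)
qed

lemma remd_eq: "remd x = lowpoly (sol x)"
  by (rule fps_ext) (auto simp: lowpoly_nth sol_nth remd_def wdiv_rem_def)

lemma lowpoly_norm_le: "fps_norm_le K (lowpoly c) (\<Sum>i=1..CARD('n). \<bar>c $ e i\<bar> * K ^ (CARD('n) - i))"
  unfolding lowpoly_def using K
  by (intro fps_norm_le_sum fps_norm_le_mult fps_norm_le_const fps_norm_le_X_power)

lemma lowpoly_norm_le_mu:
  assumes "\<And>k. \<bar>x $ k\<bar> < \<epsilon>"
  shows "fps_norm_le K (lowpoly x) \<mu>"
proof (rule fps_norm_le_mono[OF lowpoly_norm_le])
  show "(\<Sum>i=1..CARD('n). \<bar>x $ e i\<bar> * K ^ (CARD('n) - i)) \<le> \<mu>"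
    unfolding mu sum_distrib_left using K by (intro sum_mono mult_right_mono less_imp_le assms) auto
qed

lemma lowpoly_maj_norm_le: "fps_norm_le K lowpoly_maj \<mu>"
  unfolding lowpoly_maj_def lowpoly_def mu sum_distrib_left vec_lambda_beta using K eps fps_norm_le_const[of K \<epsilon>]
  by (intro fps_norm_le_sum fps_norm_le_mult fps_norm_le_X_power) auto

lemma wser_norm_le:
  assumes "\<And>k. \<bar>x $ k\<bar> < \<epsilon>"
  shows "fps_norm_le K (wser x) (1 / 3 * K ^ CARD('n))"
  unfolding wser_def using K
  by (intro fps_norm_le_mono[OF _ small] fps_norm_le_sum fps_norm_le_mult fps_norm_le_X_power
      fps_subst_norm_le(1) lowpoly_norm_le_mu assms conv)

lemma wser_maj_norm_le: "fps_norm_le K wser_maj (1 / 3 * K ^ CARD('n))"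
proof (rule fps_norm_le_mono[OF _ small])
  have "fps_norm_le K (fps_subst (Abs_fps (\<lambda>l. \<bar>fps_nth (V i) l\<bar>)) lowpoly_maj)
      (\<Sum>l. \<bar>fps_nth (V i) l\<bar> * \<mu> ^ l)" if "i \<in> {1..CARD('n)}" for i
    using fps_subst_norm_le(1)[OF lowpoly_maj_norm_le, of "Abs_fps (\<lambda>l. \<bar>fps_nth (V i) l\<bar>)"]
      conv[OF that] K by simp
  then show "fps_norm_le K wser_maj
      (\<Sum>i=1..CARD('n). K ^ (CARD('n) - i) * (\<Sum>l. \<bar>fps_nth (V i) l\<bar> * \<mu> ^ l))"
    unfolding wser_maj_def using K
    by (intro fps_norm_le_sum fps_norm_le_mult fps_norm_le_X_power)
qed

lemma X_norm_le: "fps_norm_le K (fps_X ^ CARD('n)) (K ^ CARD('n))"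
  by (rule fps_norm_le_X_power[OF K])

section \<open>Existence, size and uniqueness of the Weierstrass polynomial\<close>

lemma division:
  assumes "\<And>k. \<bar>x $ k\<bar> < \<epsilon>"
  shows "fps_X ^ CARD('n) - remd x = quot x * (fps_X ^ CARD('n) - wser x)"
  using weierstrass_division[OF K _ _ wser_norm_le[OF assms] X_norm_le]
  by (simp add: quot_def remd_def algebra_simps)

text \<open>Split X^n - s = q X^n - q w at index n: the upper part shows that 1 - q is minus the
  shift of q w, the lower part that s is its truncation. With N the norm of 1 - q this gives N \<le>
  (1 + N)/3, so N \<le> 1/2, and s has norm at most (3/2)(1/3) K^n.\<close>

lemma quot_norm_le:
  assumes x: "\<And>k. \<bar>x $ k\<bar> < \<epsilon>"
  shows "fps_norm_le K (1 - quot x) (1 / 2)" "fps_norm_le K (remd x) (1 / 2 * K ^ CARD('n))"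
proof -
  let ?q = "quot x" and ?w = "wser x"
  have eq: "fps_X ^ CARD('n) - remd x = ?q * fps_X ^ CARD('n) - ?q * ?w"
    using division[OF x] by (simp add: algebra_simps)
  have nth: "fps_nth (fps_X ^ CARD('n)) b - fps_nth (remd x) b
     = (if b < CARD('n) then 0 else fps_nth ?q (b - CARD('n))) - fps_nth (?q * ?w) b" for b
    using arg_cong[OF eq, of "\<lambda>F. fps_nth F b"] by (simp add: fps_X_power_mult_right_nth)
  have hi: "1 - ?q = - fps_shift CARD('n) (?q * ?w)"
  proof (rule fps_ext)
    fix b show "fps_nth (1 - ?q) b = fps_nth (- fps_shift CARD('n) (?q * ?w)) b"
      using nth[of "b + CARD('n)"] by (auto simp: fps_X_power_nth remd_eq lowpoly_nth)
  qed
  have lo: "remd x = fps_cutoff CARD('n) (?q * ?w)"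
  proof (rule fps_ext)
    fix b show "fps_nth (remd x) b = fps_nth (fps_cutoff CARD('n) (?q * ?w)) b"
      using nth[of b] by (auto simp: fps_X_power_nth remd_eq lowpoly_nth)
  qed
  have one: "fps_norm_le K 1 1" using fps_norm_le_const[of K 1] by simp
  have qw: "fps_norm_le K (?q * ?w) ((1 + C) * (1 / 3 * K ^ CARD('n)))" if "fps_norm_le K (1 - ?q) C" for C
    using fps_norm_le_diff[OF one that K] by (intro fps_norm_le_mult wser_norm_le x K) simp
  obtain C where "fps_norm_le K ?q C"
    using wdiv_quot_norm_le[OF K _ _ wser_norm_le[OF x] X_norm_le] by (auto simp: quot_def)
  from fps_norm_le_diff[OF one this K] have fin: "fps_norm_le K (1 - ?q) (1 + C)" .
  \<comment> \<open>The exact norm, finite by \<open>fin\<close>; finiteness is what permits solving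
    the inequality for \<open>N\<close>.\<close>
  define N where "N = (\<Sum>k. \<bar>fps_nth (1 - ?q) k\<bar> * K ^ k)"
  have "fps_norm_le K (1 - ?q) N"
    using fps_norm_le_summable[OF fin K] by (simp add: fps_norm_le_iff_suminf K N_def)
  from fps_norm_le_shift[OF qw[OF this] K, of "CARD('n)"] have "fps_norm_le K (1 - ?q) ((1 + N) / 3)"
    using hi K by simp
  then have "N \<le> (1 + N) / 3"
    unfolding fps_norm_le_iff_suminf[OF K] N_def by blast
  with \<open>fps_norm_le K (1 - ?q) N\<close> show *: "fps_norm_le K (1 - ?q) (1 / 2)"
    by (elim fps_norm_le_mono) simp
  show "fps_norm_le K (remd x) (1 / 2 * K ^ CARD('n))"
    using fps_norm_le_cutoff[OF qw[OF *] K, of "CARD('n)"] by (simp add: lo)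
qed

lemma sol_bound:
  assumes x: "\<And>k. \<bar>x $ k\<bar> < \<epsilon>"
  shows "(\<Sum>i=1..CARD('n). \<bar>sol x $ e i\<bar> * K ^ (CARD('n) - i)) \<le> 1 / 2 * K ^ CARD('n)"
proof -
  have "(\<Sum>i=1..CARD('n). \<bar>sol x $ e i\<bar> * K ^ (CARD('n) - i)) = (\<Sum>i=1..CARD('n). \<bar>fps_nth (remd x) (CARD('n) - i)\<bar> * K ^ (CARD('n) - i))"
    by (rule sum.cong) (auto simp: sol_nth)
  also have "\<dots> = (\<Sum>b<CARD('n). \<bar>fps_nth (remd x) b\<bar> * K ^ b)"
    by (rule sum.reindex_bij_witness[where i = "\<lambda>b. CARD('n) - b" and j = "\<lambda>i. CARD('n) - i"]) auto
  also have "\<dots> \<le> 1 / 2 * K ^ CARD('n)"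
    by (rule fps_norm_leD[OF quot_norm_le(2)[OF x]])
  finally show ?thesis .
qed

lemma quot_inverse:
  assumes x: "\<And>k. \<bar>x $ k\<bar> < \<epsilon>"
  shows "fps_norm_le K (inverse (quot x)) 2"
    and "fps_X ^ CARD('n) - wser x = inverse (quot x) * (fps_X ^ CARD('n) - remd x)"
proof -
  note q = fps_inverse_norm_le[OF quot_norm_le(1)[OF x] _ K]
  show "fps_norm_le K (inverse (quot x)) 2" using q(2) by simp
  have "inverse (quot x) * quot x = 1" using q(1) by (simp add: inverse_mult_eq_1)
  then show "fps_X ^ CARD('n) - wser x = inverse (quot x) * (fps_X ^ CARD('n) - remd x)"
    by (simp add: division[OF x] flip: mult.assoc)
qed

text \<open>If r = h p, then p_x = q r = q h p, so (q h - 1) p is a difference of monic polynomials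
  of degree n and has degree below n. Uniqueness of the quotient forces q h = 1.\<close>

lemma dvd_iff_sol:
  assumes x: "\<And>k. \<bar>x $ k\<bar> < \<epsilon>" and c: "fps_norm_le K (lowpoly c) (2 / 3 * K ^ CARD('n))"
  shows "(\<exists>h B. fps_norm_le K h B \<and> fps_X ^ CARD('n) - wser x = h * (fps_X ^ CARD('n) - lowpoly c)) \<longleftrightarrow> c = sol x"
proof
  assume "\<exists>h B. fps_norm_le K h B \<and> fps_X ^ CARD('n) - wser x = h * (fps_X ^ CARD('n) - lowpoly c)"
  then obtain h B where h: "fps_norm_le K h B" "fps_X ^ CARD('n) - wser x = h * (fps_X ^ CARD('n) - lowpoly c)"
    by blast
  let ?d = "quot x * h - 1"
  have d: "?d * (fps_X ^ CARD('n) - lowpoly c) = lowpoly c - remd x"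
    using division[OF x] h(2) by (simp add: algebra_simps)
  have one: "fps_norm_le K 1 1" using fps_norm_le_const[of K 1] by simp
  have "fps_norm_le K (quot x) (1 + 1 / 2)"
    using fps_norm_le_diff[OF one quot_norm_le(1)[OF x] K] by simp
  then have dn: "fps_norm_le K ?d ((1 + 1 / 2) * B + 1)"
    by (intro fps_norm_le_diff fps_norm_le_mult one h(1) K)
  have "?d = 0"
    by (rule weierstrass_quotient_unique[OF K _ _ c dn]) (simp_all add: d remd_eq lowpoly_nth)
  with d have "lowpoly c = lowpoly (sol x)" by (simp add: remd_eq)
  then show "c = sol x" by (rule lowpoly_inject)
next
  assume "c = sol x"
  then show "\<exists>h B. fps_norm_le K h B \<and> fps_X ^ CARD('n) - wser x = h * (fps_X ^ CARD('n) - lowpoly c)"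
    using quot_inverse[OF x] by (auto simp: remd_eq)
qed

text \<open>On this axis m_x is the constant t, so w_x is already a polynomial of degree below n
  with coefficients v_i(t), and r_x is its own Weierstrass polynomial, with cofactor 1.\<close>

lemma sol_initial:
  assumes x: "\<And>k. \<bar>(t *\<^sub>R axis (e CARD('n)) 1 :: real ^ 'n) $ k\<bar> < \<epsilon>" and i: "i \<in> {1..CARD('n)}"
  shows "sol (t *\<^sub>R axis (e CARD('n)) 1) $ e i = (\<Sum>l. fps_nth (V i) l * t ^ l)"
proof -
  let ?x = "t *\<^sub>R axis (e CARD('n)) 1 :: real ^ 'n"
  define c :: "real ^ 'n" where "c = (\<chi> k. \<Sum>l. fps_nth (V (inv_into {1..CARD('n)} e k)) l * t ^ l)"
  have c: "c $ e i = (\<Sum>l. fps_nth (V i) l * t ^ l)" if "i \<in> {1..CARD('n)}" for i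
    using that by (simp only: c_def vec_lambda_beta inv_e)
  have "CARD('n) \<ge> 1" by (simp add: Suc_le_eq)
  have low: "lowpoly ?x = fps_const t"
  proof (rule fps_ext)
    fix b
    have "e (CARD('n) - b) = e CARD('n) \<longleftrightarrow> b = 0" if "b < CARD('n)"
      using inj_e[of "CARD('n) - b" "CARD('n)"] that by auto
    then show "fps_nth (lowpoly ?x) b = fps_nth (fps_const t) b"
      by (auto simp: lowpoly_nth axis_def)
  qed
  have "fps_subst (V i) (fps_const t) = fps_const (c $ e i)" if "i \<in> {1..CARD('n)}" for i
    by (rule fps_ext) (simp add: fps_subst_def c[OF that])
  then have w: "wser ?x = lowpoly c"
    unfolding wser_def low lowpoly_def[of c] by (intro sum.cong) (auto simp: mult.commute)
  have "fps_norm_le K (lowpoly c) (2 / 3 * K ^ CARD('n))"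
    using fps_norm_le_mono[OF wser_norm_le[OF x]] K unfolding w by simp
  moreover have "fps_norm_le K 1 1" using fps_norm_le_const[of K 1] by simp
  ultimately have "c = sol ?x"
    by (subst dvd_iff_sol[OF x, symmetric]) (auto simp: w intro!: exI[of _ 1])
  with c[OF i] show ?thesis by simp
qed

lemma cube_radius:
  fixes a :: "real ^ 'n"
  assumes "\<And>k. \<bar>a $ k\<bar> < \<epsilon>"
  obtains \<rho> where "\<rho> > 0" "\<And>k. \<bar>a $ k\<bar> + \<rho> \<le> \<epsilon>"
proof
  let ?\<rho> = "Min (range (\<lambda>k. \<epsilon> - \<bar>a $ k\<bar>))"
  show "?\<rho> > 0" using assms by (subst Min_gr_iff) auto
  show "\<bar>a $ k\<bar> + ?\<rho> \<le> \<epsilon>" for k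
  proof -
    have "?\<rho> \<le> \<epsilon> - \<bar>a $ k\<bar>" by (rule Min_le) auto
    then show ?thesis by linarith
  qed
qed

section \<open>Analytic dependence on the parameters and the PDEs\<close>

context
  fixes a :: "real ^ 'n" and \<rho> :: real
  assumes rho: "\<rho> > 0" and cube: "\<And>k. \<bar>a $ k\<bar> + \<rho> \<le> \<epsilon>"
begin

lemma in_cube: "\<bar>a $ k\<bar> < \<epsilon>"
  using cube[of k] rho by linarith

lemma lowpoly_majorant: "fps_majorant a \<rho> lowpoly lowpoly_maj"
proof -
  have "fps_majorant a \<rho> (\<lambda>x. fps_const (x $ k)) (fps_const \<epsilon>)" for k
    unfolding fps_majorant_def
  proof
    fix b
    show "\<exists>c. ps_expansion a \<rho> c (fps_nth (fps_const \<epsilon>) b) (\<lambda>x. fps_nth (fps_const (x $ k)) b)"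
      using ps_expansion_mono[OF ps_expansion_coord[OF rho] cube[of k]] ps_expansion_zero[of 0 a \<rho>]
      by (cases "b = 0") auto
  qed
  then have "fps_majorant a \<rho> (\<lambda>x. \<Sum>i=1..CARD('n). fps_const (x $ e i) * fps_X ^ (CARD('n) - i)) lowpoly_maj"
    unfolding lowpoly_maj_def lowpoly_def vec_lambda_beta by (intro fps_majorant_sum fps_majorant_mult fps_majorant_X_power rho)
  then show ?thesis by (simp add: lowpoly_def[abs_def])
qed

lemma wser_majorant: "fps_majorant a \<rho> wser wser_maj"
proof -
  have "fps_majorant a \<rho> (\<lambda>x. \<Sum>i=1..CARD('n). fps_X ^ (CARD('n) - i) * fps_subst (V i) (lowpoly x)) wser_maj"
    unfolding wser_maj_def
    by (intro fps_majorant_sum fps_majorant_mult fps_majorant_X_power rho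
        fps_majorant_subst[OF lowpoly_majorant rho lowpoly_maj_norm_le conv K])
  then show ?thesis by (simp add: wser_def[abs_def])
qed

lemma quot_majorant: "fps_majorant a \<rho> quot (wdiv_quot CARD('n) wser_maj (fps_X ^ CARD('n)))"
  and remd_majorant: "fps_majorant a \<rho> remd (wdiv_rem CARD('n) wser_maj (fps_X ^ CARD('n)))"
  using fps_majorant_wdiv[OF wser_majorant fps_majorant_X_power rho
      wdiv_iter_summable[OF K _ _ wser_maj_norm_le X_norm_le]]
  by (simp_all add: quot_def[abs_def] remd_def[abs_def])

lemma lowpoly_partial:
  assumes j: "j \<in> {1..CARD('n)}"
  shows "has_fps_partial (e j) lowpoly (fps_X ^ (CARD('n) - j)) a"
  unfolding has_fps_partial_def
proof
  fix b
  have "e (CARD('n) - b) = e j \<longleftrightarrow> b = CARD('n) - j" if "b < CARD('n)"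
    using inj_e[of "CARD('n) - b" j] j that by auto
  then have "fps_nth (lowpoly (a + t *\<^sub>R axis (e j) 1)) b =
      fps_nth (lowpoly a) b + t * fps_nth (fps_X ^ (CARD('n) - j)) b" for t
    using j by (auto simp: lowpoly_nth fps_X_power_nth axis_def)
  then show "((\<lambda>t. fps_nth (lowpoly (a + t *\<^sub>R axis (e j) 1)) b) has_real_derivative
      fps_nth (fps_X ^ (CARD('n) - j)) b) (at 0)"
    by (simp only:) (rule derivative_eq_intros refl | simp)+
qed

text \<open>T is the sum of X^(n-i) v_i'(m_a). One T serves every \<open>j\<close>, since x^j enters
  m_x only through the term x^j X^(n-j).\<close>

lemma wser_partial: "\<exists>T. \<forall>j\<in>{1..CARD('n)}. has_fps_partial (e j) wser (fps_X ^ (CARD('n) - j) * T) a"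
proof -
  define E where "E i = Abs_fps (\<lambda>b. \<Sum>l. fps_nth (fps_const (fps_nth (V i) l) *
      (of_nat l * lowpoly a ^ (l - 1))) b)" for i
  have "has_fps_partial (e j) wser (fps_X ^ (CARD('n) - j) * (\<Sum>i=1..CARD('n). fps_X ^ (CARD('n) - i) * E i)) a"
    if j: "j \<in> {1..CARD('n)}" for j
  proof -
    have "has_fps_partial (e j) (\<lambda>x. fps_X ^ (CARD('n) - i) * fps_subst (V i) (lowpoly x))
        (fps_X ^ (CARD('n) - i) * (fps_X ^ (CARD('n) - j) * E i)) a" if i: "i \<in> {1..CARD('n)}" for i
    proof (rule has_fps_partial_cmult)
      note sub = has_fps_partial_subst[OF lowpoly_majorant rho lowpoly_maj_norm_le]
      note sub2 = sub[OF conv[OF i]]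
      note sub3 = sub2[OF K]
      note sub4 = sub3[OF lowpoly_partial[OF j]]
      show "has_fps_partial (e j) (\<lambda>x. fps_subst (V i) (lowpoly x)) (fps_X ^ (CARD('n) - j) * E i) a"
        unfolding E_def by (rule sub4)
    qed
    from has_fps_partial_sum[OF this]
    have "has_fps_partial (e j) (\<lambda>x. \<Sum>i=1..CARD('n). fps_X ^ (CARD('n) - i) * fps_subst (V i) (lowpoly x))
        (\<Sum>i=1..CARD('n). fps_X ^ (CARD('n) - i) * (fps_X ^ (CARD('n) - j) * E i)) a" .
    then show ?thesis by (simp add: wser_def[abs_def] sum_distrib_left mult.left_commute)
  qed
  then show ?thesis by blast
qed

lemma eventually_in_cube: "\<forall>\<^sub>F t in nhds 0. \<forall>k. \<bar>(a + t *\<^sub>R axis m 1) $ k\<bar> < \<epsilon>"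
proof -
  have "\<forall>\<^sub>F t in nhds (0::real). dist t 0 < \<rho>"
    using rho eventually_nhds_metric by blast
  then show ?thesis
  proof eventually_elim
    case (elim t)
    show ?case
    proof
      fix k
      have "\<bar>(a + t *\<^sub>R axis m 1) $ k\<bar> \<le> \<bar>a $ k\<bar> + \<bar>t\<bar>"
        by (auto simp: axis_def)
      also have "\<dots> < \<epsilon>" using elim cube[of k] by simp
      finally show "\<bar>(a + t *\<^sub>R axis m 1) $ k\<bar> < \<epsilon>" .
    qed
  qed
qed

lemma remd_partial:
  assumes "has_fps_partial m quot D a" "has_fps_partial m wser E a"
  shows "has_fps_partial m remd (quot a * E - D * (fps_X ^ CARD('n) - wser a)) a"
proof -
  have *: "has_fps_partial m (\<lambda>x. fps_X ^ CARD('n) - quot x * (fps_X ^ CARD('n) - wser x))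
      (0 - (D * (fps_X ^ CARD('n) - wser a) + quot a * (0 - E))) a"
    by (intro has_fps_partial_diff has_fps_partial_mult has_fps_partial_const assms)
  show ?thesis
    unfolding has_fps_partial_def
  proof
    fix b
    let ?y = "\<lambda>t. a + t *\<^sub>R axis m 1"
    have "((\<lambda>t. fps_nth (fps_X ^ CARD('n) - quot (?y t) * (fps_X ^ CARD('n) - wser (?y t))) b) has_real_derivative
      fps_nth (quot a * E - D * (fps_X ^ CARD('n) - wser a)) b) (at 0)"
      using * by (simp add: has_fps_partial_def algebra_simps)
    \<comment> \<open>The division identity is available only inside the cube, so the two functions
      are compared near t = 0, which suffices for the derivative.\<close>
    moreover have "\<forall>\<^sub>F t in nhds 0. fps_nth (remd (?y t)) b
        = fps_nth (fps_X ^ CARD('n) - quot (?y t) * (fps_X ^ CARD('n) - wser (?y t))) b"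
      using eventually_in_cube[of m]
    proof eventually_elim
      case (elim t)
      then have "remd (?y t) = fps_X ^ CARD('n) - quot (?y t) * (fps_X ^ CARD('n) - wser (?y t))"
        using division[of "?y t"] by (simp add: algebra_simps)
      then show ?case by simp
    qed
    ultimately show "((\<lambda>t. fps_nth (remd (?y t)) b) has_real_derivative
      fps_nth (quot a * E - D * (fps_X ^ CARD('n) - wser a)) b) (at 0)"
      by (subst DERIV_cong_ev[OF refl _ refl]) auto
  qed
qed

text \<open>In the product rule for p = q r the terms with derivatives of r cancel, leaving a
  multiple of r, hence of p because q is a unit. In degree n only the top coefficient of
  \<open>S (Suc j)\<close>, moved up by X, survives; subtracting that multiple of p leaves degree
  below n, and the cofactor vanishes by uniqueness.\<close>

lemma remd_partials:
  "\<exists>S. \<forall>j\<in>{1..CARD('n)}. has_fps_partial (e j) remd (S j) a \<and> (\<forall>b\<ge>CARD('n). fps_nth (S j) b = 0)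
    \<and> (j < CARD('n) \<longrightarrow> fps_X * S (Suc j) - S j = fps_const (fps_nth (S (Suc j)) (CARD('n) - 1)) * (fps_X ^ CARD('n) - remd a))"
proof -
  obtain T where T: "\<And>j. j \<in> {1..CARD('n)} \<Longrightarrow> has_fps_partial (e j) wser (fps_X ^ (CARD('n) - j) * T) a"
    using wser_partial by blast
  obtain C where C: "fps_norm_le K (wdiv_quot CARD('n) wser_maj (fps_X ^ CARD('n))) C"
    using wdiv_quot_norm_le[OF K _ _ wser_maj_norm_le X_norm_le] by auto
  obtain D where D: "\<And>m. has_fps_partial m quot (D m) a" "\<And>m. fps_norm_le K (D m) (C / \<rho>)"
    using fps_majorant_has_fps_partial[OF quot_majorant C rho K] by metis
  define S where "S j = quot a * (fps_X ^ (CARD('n) - j) * T) - D (e j) * (fps_X ^ CARD('n) - wser a)" for j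
  have S: "has_fps_partial (e j) remd (S j) a" if "j \<in> {1..CARD('n)}" for j
    unfolding S_def by (rule remd_partial[OF D(1) T[OF that]])
  have S0: "fps_nth (S j) b = 0" if "j \<in> {1..CARD('n)}" "b \<ge> CARD('n)" for j b
  proof -
    have "((\<lambda>t. fps_nth (remd (a + t *\<^sub>R axis (e j) 1)) b) has_real_derivative fps_nth (S j) b) (at 0)"
      using S[OF that(1)] by (simp add: has_fps_partial_def)
    moreover have "fps_nth (remd x) b = 0" for x using that by (simp add: remd_eq lowpoly_nth)
    ultimately have "((\<lambda>t::real. 0::real) has_real_derivative fps_nth (S j) b) (at 0)" by simp
    from DERIV_unique[OF this DERIV_const] show ?thesis .
  qed
  have "fps_X * S (Suc j) - S j = fps_const (fps_nth (S (Suc j)) (CARD('n) - 1)) * (fps_X ^ CARD('n) - remd a)"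
    if j: "j \<in> {1..CARD('n)}" "j < CARD('n)" for j
  proof -
    let ?z = "D (e j) - fps_X * D (e (Suc j))" and ?\<kappa> = "fps_const (fps_nth (S (Suc j)) (CARD('n) - 1))"
    have pw: "(fps_X :: real fps) ^ (CARD('n) - j) = fps_X * fps_X ^ (CARD('n) - Suc j)"
      using j by (simp add: Suc_diff_Suc flip: power_Suc)
    have "fps_X * S (Suc j) - S j = ?z * (fps_X ^ CARD('n) - wser a)"
      unfolding S_def pw by (simp only: algebra_simps)
    also have "\<dots> = ?z * inverse (quot a) * (fps_X ^ CARD('n) - remd a)"
      using quot_inverse(2)[OF in_cube] by (simp add: mult.assoc)
    finally have eq: "fps_X * S (Suc j) - S j = ?z * inverse (quot a) * (fps_X ^ CARD('n) - remd a)" .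
    define h where "h = ?z * inverse (quot a) - ?\<kappa>"
    have heq: "h * (fps_X ^ CARD('n) - remd a) = fps_X * S (Suc j) - S j - ?\<kappa> * (fps_X ^ CARD('n) - remd a)"
      unfolding eq h_def by (simp add: algebra_simps)
    have "fps_norm_le K h ((C / \<rho> + K ^ 1 * (C / \<rho>)) * 2 + \<bar>fps_nth (S (Suc j)) (CARD('n) - 1)\<bar>)"
      unfolding h_def
      by (intro fps_norm_le_diff fps_norm_le_mult D quot_inverse(1) in_cube K fps_norm_le_const
          fps_norm_le_X_power[OF K, of 1, unfolded power_one_right[of "fps_X :: real fps"]])
    moreover have "fps_nth (h * (fps_X ^ CARD('n) - remd a)) b = 0" if "b \<ge> CARD('n)" for b
    proof -
      have "b > 0" using that j by linarith
      have "fps_nth (S j) b = 0" by (rule S0[OF j(1) that])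
      moreover have "fps_nth (S (Suc j)) (b - 1) = (if b = CARD('n) then fps_nth (S (Suc j)) (CARD('n) - 1) else 0)"
        using S0[of "Suc j" "b - 1"] j that by auto
      moreover have "fps_nth (remd a) b = 0" using that by (simp add: remd_eq lowpoly_nth)
      ultimately show ?thesis
        unfolding heq using \<open>b > 0\<close> by (simp add: fps_X_power_nth)
    qed
    ultimately have "h = 0"
      by (rule weierstrass_quotient_unique[OF K _ _ quot_norm_le(2)[OF in_cube], rotated 2]) simp_all
    with heq show ?thesis by simp
  qed
  with S S0 show ?thesis by blast
qed

lemma sol_partial:
  assumes "has_fps_partial (e j) remd S a" "i \<in> {1..CARD('n)}"
  shows "partial_deriv (e j) (\<lambda>y. sol y $ e i) a = fps_nth S (CARD('n) - i)"
  using has_fps_partial_partial_deriv[OF assms(1)] assms(2) by (simp add: sol_nth)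

text \<open>Coefficient of X^(n-i) in the identity for the remainders; the constant factor there is
  the derivative of f_1. For i = n it is the constant coefficient, to which X times a series
  contributes nothing, so both families of equations are covered.\<close>

lemma sol_pde:
  assumes i: "i \<in> {1..CARD('n)}" and j: "j \<in> {1..<CARD('n)}"
  shows "partial_deriv (e j) (\<lambda>y. sol y $ e i) a =
      sol a $ e i * partial_deriv (e (j + 1)) (\<lambda>y. sol y $ e 1) a +
      (if i < CARD('n) then partial_deriv (e (j + 1)) (\<lambda>y. sol y $ e (i + 1)) a else 0)"
proof -
  obtain S where S: "\<And>j. j \<in> {1..CARD('n)} \<Longrightarrow> has_fps_partial (e j) remd (S j) a"
    and eq: "\<And>j. j \<in> {1..CARD('n)} \<Longrightarrow> j < CARD('n) \<Longrightarrow>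
      fps_X * S (Suc j) - S j = fps_const (fps_nth (S (Suc j)) (CARD('n) - 1)) * (fps_X ^ CARD('n) - remd a)"
    using remd_partials by blast
  have "fps_nth (fps_X * S (Suc j) - S j) (CARD('n) - i) =
      fps_nth (fps_const (fps_nth (S (Suc j)) (CARD('n) - 1)) * (fps_X ^ CARD('n) - remd a)) (CARD('n) - i)"
    using eq[of j] j by simp
  moreover have "CARD('n) - i \<noteq> CARD('n)" using i by auto
  ultimately have "fps_nth (S j) (CARD('n) - i) = sol a $ e i * fps_nth (S (Suc j)) (CARD('n) - 1) +
      (if i < CARD('n) then fps_nth (S (Suc j)) (CARD('n) - (i + 1)) else 0)"
    using i by (auto simp: fps_X_power_nth sol_nth algebra_simps)
  moreover have "j \<in> {1..CARD('n)}" "Suc j \<in> {1..CARD('n)}" "1 \<in> {1..CARD('n)}" using j by auto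
  ultimately show ?thesis
    using i by (simp add: sol_partial[OF S])
qed

lemma sol_expansion:
  assumes "i \<in> {1..CARD('n)}"
  shows "\<exists>c B. ps_expansion a \<rho> c B (\<lambda>x. sol x $ e i)"
  unfolding sol_nth[OF assms] using fps_majorantD[OF remd_majorant] by blast

end

section \<open>Evaluation of the family at a matrix\<close>

context
  fixes L :: "real ^ 'n ^ 'n" and B :: real
  assumes pow: "\<And>k. norm (matpow L k) \<le> B * K ^ k"
begin

text \<open>Used with \<open>y = x\<close>, where it turns powers of m_x into powers of
  \<open>M\<close>, and with \<open>y = c\<close>, where Cayley-Hamilton identifies
  \<open>mat_M e c L\<close> with L^n.\<close>

lemma fps_matrix_lowpoly_mult:
  assumes "fps_norm_le K F C"
  shows "fps_matrix L (lowpoly y * F) = mat_M e y L ** fps_matrix L F"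
proof -
  have XF: "fps_norm_le K (fps_X ^ m * F) (K ^ m * C)" for m
    by (intro fps_norm_le_mult fps_norm_le_X_power assms K)
  have "lowpoly y * F = (\<Sum>i=1..CARD('n). fps_const (y $ e i) * (fps_X ^ (CARD('n) - i) * F))"
    by (simp add: lowpoly_def sum_distrib_right mult.assoc)
  also have "fps_matrix L \<dots> = (\<Sum>i=1..CARD('n). fps_matrix L (fps_const (y $ e i) * (fps_X ^ (CARD('n) - i) * F)))"
    by (rule fps_matrix_sum[OF K pow]) (rule fps_norm_le_mult[OF fps_norm_le_const XF K])
  also have "\<dots> = (\<Sum>i=1..CARD('n). (y $ e i) *\<^sub>R (matpow L (CARD('n) - i) ** fps_matrix L F))"
    by (simp only: fps_matrix_cmult[OF K pow XF] fps_matrix_X_power_mult(1)[OF K pow assms])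
  also have "\<dots> = mat_M e y L ** fps_matrix L F"
    unfolding mat_M_def linear_sum[OF bounded_linear.linear[OF bounded_linear_matrix_mult_right]]
    by (simp only: scaleR_matrix_mult_left)
  finally show ?thesis .
qed

context
  fixes x :: "real ^ 'n"
  assumes x: "\<And>k. \<bar>x $ k\<bar> < \<epsilon>"
begin

lemma lowpoly_power_norm_le: "fps_norm_le K (lowpoly x ^ l) (\<mu> ^ l)"
  by (intro fps_norm_le_power lowpoly_norm_le_mu x K)

lemma fps_matrix_lowpoly_power: "fps_matrix L (lowpoly x ^ l) = matpow (mat_M e x L) l"
proof (induction l)
  case 0
  then show ?case by (simp add: fps_matrix_one[OF K pow])
next
  case (Suc l)
  then show ?case by (simp add: fps_matrix_lowpoly_mult[OF lowpoly_power_norm_le])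
qed

lemma mat_fps_sums:
  assumes "i \<in> {1..CARD('n)}"
  shows "(\<lambda>l. fps_nth (V i) l *\<^sub>R matpow (mat_M e x L) l) sums fps_matrix L (fps_subst (V i) (lowpoly x))"
proof -
  have "(\<lambda>l. fps_matrix L (fps_const (fps_nth (V i) l) * lowpoly x ^ l)) sums fps_matrix L (fps_subst (V i) (lowpoly x))"
    unfolding fps_subst_def
    by (rule fps_matrix_suminf[OF K pow _ conv[OF assms]])
       (intro fps_norm_le_mult fps_norm_le_const lowpoly_power_norm_le K)
  then show ?thesis
    by (simp only: fps_matrix_cmult[OF K pow lowpoly_power_norm_le] fps_matrix_lowpoly_power)
qed

lemma mat_fps_convergent_mat_M:
  "i \<in> {1..CARD('n)} \<Longrightarrow> mat_fps_convergent (V i) (mat_M e x L)"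
  using mat_fps_sums unfolding mat_fps_convergent_def by (blast intro: sums_summable)

lemma mat_r_eq: "mat_r V L (mat_M e x L) = fps_matrix L (fps_X ^ CARD('n) - wser x)"
proof -
  have S: "\<exists>C. fps_norm_le K (fps_subst (V i) (lowpoly x)) C" if "i \<in> {1..CARD('n)}" for i
    using fps_subst_norm_le(1)[OF lowpoly_norm_le_mu[OF x] conv[OF that] K] by blast
  have XS: "\<exists>C. fps_norm_le K (fps_X ^ (CARD('n) - i) * fps_subst (V i) (lowpoly x)) C"
    if "i \<in> {1..CARD('n)}" for i
    using S[OF that] fps_norm_le_mult[OF fps_norm_le_X_power[OF K] _ K] by blast
  then obtain C where C: "\<And>i. i \<in> {1..CARD('n)} \<Longrightarrow>
      fps_norm_le K (fps_X ^ (CARD('n) - i) * fps_subst (V i) (lowpoly x)) (C i)"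
    by metis
  have "fps_matrix L (wser x) =
      (\<Sum>i=1..CARD('n). fps_matrix L (fps_X ^ (CARD('n) - i) * fps_subst (V i) (lowpoly x)))"
    unfolding wser_def by (rule fps_matrix_sum[OF K pow C])
  also have "\<dots> = (\<Sum>i=1..CARD('n). mat_fps (V i) (mat_M e x L) ** matpow L (CARD('n) - i))"
  proof (rule sum.cong[OF refl])
    fix i assume i: "i \<in> {1..CARD('n)}"
    then obtain C where "fps_norm_le K (fps_subst (V i) (lowpoly x)) C" using S by blast
    from fps_matrix_X_power_mult(2)[OF K pow this]
    show "fps_matrix L (fps_X ^ (CARD('n) - i) * fps_subst (V i) (lowpoly x)) =
        mat_fps (V i) (mat_M e x L) ** matpow L (CARD('n) - i)"
      using sums_unique[OF mat_fps_sums[OF i]] by (simp only: mat_fps_def)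
  qed
  finally show ?thesis
    unfolding mat_r_def fps_matrix_diff[OF K pow X_norm_le wser_norm_le[OF x]]
    by (simp only: fps_matrix_X_power[OF K pow])
qed

end

end

text \<open>Multiples of the characteristic polynomial p vanish at \<open>L\<close>. Conversely, the
  Weierstrass remainder of r_x modulo p is a polynomial of degree below n vanishing at
  \<open>L\<close>, hence zero by regularity. The bound on \<open>c\<close> yields both the division
  by p and the growth bound for powers of \<open>L\<close>, so the series v_i(M) converge.\<close>

lemma matrix_relation_iff_sol:
  fixes L :: "real ^ 'n ^ 'n"
  assumes x: "\<And>k. \<bar>x $ k\<bar> < \<epsilon>" and reg: "gl_regular L" and hc: "has_char_coeffs e L c"
    and c: "(\<Sum>i=1..CARD('n). \<bar>c $ e i\<bar> * K ^ (CARD('n) - i)) < 2 / 3 * K ^ CARD('n)"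
  shows "matrix_relation e V x L \<longleftrightarrow> c = sol x"
proof -
  let ?n = "CARD('n)" and ?r = "fps_X ^ CARD('n) - wser x" and ?p = "fps_X ^ CARD('n) - lowpoly c"
  have "(\<Sum>i=1..?n. \<bar>c $ e i\<bar> * K ^ (?n - i)) \<le> K ^ ?n"
    using c zero_less_power[OF K, of ?n] by linarith
  from matpow_bound[OF hc K this] obtain B where pow: "\<And>k. norm (matpow L k) \<le> B * K ^ k"
    by blast
  have cn: "fps_norm_le K (lowpoly c) (2 / 3 * K ^ ?n)"
    using fps_norm_le_mono[OF lowpoly_norm_le] c by (simp add: less_imp_le)
  have rn: "fps_norm_le K ?r (K ^ ?n + 1 / 3 * K ^ ?n)"
    by (intro fps_norm_le_diff X_norm_le wser_norm_le x K)
  have ideal: "fps_matrix L (h * ?p) = 0" if h: "fps_norm_le K h C" for h C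
  proof -
    have "h * ?p = fps_X ^ ?n * h - lowpoly c * h" by (simp add: algebra_simps)
    also have "fps_matrix L \<dots> = fps_matrix L (fps_X ^ ?n * h) - fps_matrix L (lowpoly c * h)"
      by (rule fps_matrix_diff[OF K pow fps_norm_le_mult[OF X_norm_le h K] fps_norm_le_mult[OF cn h K]])
    also have "\<dots> = matpow L ?n ** fps_matrix L h - mat_M e c L ** fps_matrix L h"
      by (simp only: fps_matrix_lowpoly_mult[OF pow h] fps_matrix_X_power_mult(1)[OF K pow h])
    also have "mat_M e c L = matpow L ?n"
      unfolding mat_M_def has_char_coeffs_cayley_hamilton[OF hc] ..
    finally show ?thesis by simp
  qed
  have "matrix_relation e V x L \<longleftrightarrow> fps_matrix L ?r = 0"
    unfolding matrix_relation_def mat_r_eq[OF pow x] using mat_fps_convergent_mat_M[OF pow x] by blast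
  also have "\<dots> \<longleftrightarrow> (\<exists>h C. fps_norm_le K h C \<and> ?r = h * ?p)"
  proof
    assume "\<exists>h C. fps_norm_le K h C \<and> ?r = h * ?p"
    then obtain h C where h: "fps_norm_le K h C" "?r = h * ?p" by blast
    show "fps_matrix L ?r = 0" unfolding h(2) by (rule ideal[OF h(1)])
  next
    assume r0: "fps_matrix L ?r = 0"
    let ?h = "wdiv_quot ?n (lowpoly c) ?r" and ?s = "wdiv_rem ?n (lowpoly c) ?r"
    have div: "?r = ?h * ?p + ?s"
      by (rule weierstrass_division[OF K _ _ cn rn]) simp_all
    obtain C where h: "fps_norm_le K ?h C"
      using wdiv_quot_norm_le[OF K _ _ cn rn] by auto
    have s_high: "fps_nth ?s k = 0" if "k \<ge> ?n" for k
      using that by (simp add: wdiv_rem_def)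
    have "?s = ?r - ?h * ?p" using div by (simp add: algebra_simps)
    then have "fps_matrix L ?s = fps_matrix L ?r - fps_matrix L (?h * ?p)"
      using fps_matrix_diff[OF K pow rn fps_norm_le_mult[OF h fps_norm_le_diff[OF X_norm_le cn K] K]]
      by (simp only:)
    then have "(\<Sum>k<?n. fps_nth ?s k *\<^sub>R matpow L k) = 0"
      using r0 ideal[OF h] fps_matrix_finite[OF K pow s_high] by simp
    from gl_regular_lincomb_eq_0[OF reg this] s_high have "?s = 0"
      by (intro fps_ext) (metis fps_zero_nth not_less)
    with div h show "\<exists>h C. fps_norm_le K h C \<and> ?r = h * ?p" by auto
  qed
  also have "\<dots> \<longleftrightarrow> c = sol x" by (rule dvd_iff_sol[OF x cn])
  finally show ?thesis .
qed

end

section \<open>Choice of the parameters\<close>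

lemma weierstrass_family_exists:
  fixes e :: "nat \<Rightarrow> 'n::finite" and V :: "nat \<Rightarrow> real fps"
  assumes enum: "bij_betw e {1..CARD('n)} UNIV"
    and rad: "\<And>i. i \<in> {1..CARD('n)} \<Longrightarrow> fps_conv_radius (V i) > 0" and \<delta>: "\<delta> > 0"
  shows "\<exists>K \<epsilon> \<mu>. weierstrass_family e V K \<epsilon> \<mu> \<and> \<epsilon> < \<delta>"
proof -
  let ?n = "CARD('n)"
  define S where "S = (\<Sum>i=1..?n. \<bar>fps_nth (V i) 0\<bar>)"
  \<comment> \<open>For K \<ge> 1 the norm of w_0 is at most S K^(n-1), so K > 3 S brings it
    strictly below K^n/3; the summand 1 ensures both inequalities.\<close>
  define K where "K = 3 * S + 1"
  have S0: "S \<ge> 0" by (simp add: S_def sum_nonneg)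
  then have K: "K \<ge> 1" by (simp add: K_def)
  define \<Sigma> where "\<Sigma> = (\<Sum>j=1..?n. K ^ (?n - j))"
  have "\<Sigma> > 0" unfolding \<Sigma>_def using K by (intro sum_pos) auto
  define \<phi> where "\<phi> t = (\<Sum>i=1..?n. K ^ (?n - i) * (\<Sum>l. \<bar>fps_nth (V i) l\<bar> * t ^ l))" for t
  have "(\<phi> \<longlongrightarrow> (\<Sum>i=1..?n. K ^ (?n - i) * \<bar>fps_nth (V i) 0\<bar>)) (at_right 0)"
    unfolding \<phi>_def[abs_def] by (intro tendsto_intros fps_abs_power_series_at_0 rad)
  moreover have "(\<Sum>i=1..?n. K ^ (?n - i) * \<bar>fps_nth (V i) 0\<bar>) < 1 / 3 * K ^ ?n"
  proof -
    have "(\<Sum>i=1..?n. K ^ (?n - i) * \<bar>fps_nth (V i) 0\<bar>) \<le> (\<Sum>i=1..?n. K ^ (?n - 1) * \<bar>fps_nth (V i) 0\<bar>)"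
      using K by (intro sum_mono mult_right_mono power_increasing) auto
    also have "\<dots> = S * K ^ (?n - 1)" 
      unfolding S_def sum_distrib_right by (rule sum.cong) auto
    also have "\<dots> < K / 3 * K ^ (?n - 1)"
      using K by (intro mult_strict_right_mono) (auto simp: K_def)
    also have "\<dots> = 1 / 3 * K ^ ?n" by (simp flip: power_Suc)
    finally show ?thesis .
  qed
  ultimately have "\<forall>\<^sub>F t in at_right 0. \<phi> t < 1 / 3 * K ^ ?n"
    by (rule order_tendstoD(2))
  moreover have "\<forall>\<^sub>F t in at_right 0. \<forall>i\<in>{1..?n}. summable (\<lambda>l. \<bar>fps_nth (V i) l\<bar> * t ^ l)"
    by (intro eventually_ball_finite ballI fps_abs_power_series_at_0(1) rad) auto
  \<comment> \<open>The norm bound \<mu> is chosen and \<epsilon> = \<mu>/\<Sigma> derived from it;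
    this condition becomes 0 < \<epsilon> < \<delta>.\<close>
  moreover have "\<forall>\<^sub>F t in at_right 0. 0 < t \<and> t < \<delta> * \<Sigma>"
    unfolding eventually_at_right_field using \<delta> \<open>\<Sigma> > 0\<close> by (intro exI[of _ "\<delta> * \<Sigma>"]) auto
  ultimately have "\<forall>\<^sub>F t in at_right 0. \<phi> t < 1 / 3 * K ^ ?n \<and>
      (\<forall>i\<in>{1..?n}. summable (\<lambda>l. \<bar>fps_nth (V i) l\<bar> * t ^ l)) \<and> 0 < t \<and> t < \<delta> * \<Sigma>"
    by eventually_elim auto
  then obtain \<mu> where \<mu>: "\<phi> \<mu> < 1 / 3 * K ^ ?n" "0 < \<mu>" "\<mu> < \<delta> * \<Sigma>"
    "\<And>i. i \<in> {1..?n} \<Longrightarrow> summable (\<lambda>l. \<bar>fps_nth (V i) l\<bar> * \<mu> ^ l)"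
    by (auto dest!: eventually_happens'[OF trivial_limit_at_right_real, rotated])
  have "weierstrass_family e V K (\<mu> / \<Sigma>) \<mu>"
  proof
    show "\<mu> = \<mu> / \<Sigma> * (\<Sum>j=1..?n. K ^ (?n - j))" unfolding \<Sigma>_def[symmetric] using \<open>\<Sigma> > 0\<close> by simp
    show "(\<Sum>i=1..?n. K ^ (?n - i) * (\<Sum>l. \<bar>fps_nth (V i) l\<bar> * \<mu> ^ l)) \<le> 1 / 3 * K ^ ?n"
      using \<mu>(1) by (simp only: \<phi>_def less_imp_le)
  qed (use enum K \<mu> \<open>\<Sigma> > 0\<close> in auto)
  moreover have "\<mu> / \<Sigma> < \<delta>" using \<mu>(3) \<open>\<Sigma> > 0\<close> by (simp add: field_simps)
  ultimately show ?thesis by blast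
qed

theorem theorem1p2:
  fixes e :: "nat \<Rightarrow> 'n::finite"
    and v :: "nat \<Rightarrow> real \<Rightarrow> real"
    and V :: "nat \<Rightarrow> real fps"
  assumes enum: "bij_betw e {1..CARD('n)} UNIV"
    and v_analytic: "\<And>i. i \<in> {1..CARD('n)} \<Longrightarrow> v i has_fps_expansion V i"
  shows "\<exists>(U :: (real ^ 'n) set) (W :: (real ^ 'n) set) (f :: real ^ 'n \<Rightarrow> real ^ 'n).
    open U \<and> 0 \<in> U \<and> open W \<and> f ` U \<subseteq> W \<and>
    (\<forall>i\<in>{1..CARD('n)}. real_analytic_on (\<lambda>x. f x $ e i) U) \<and>
    (\<forall>x\<in>U. \<forall>c\<in>W. \<forall>L. gl_regular L \<and> has_char_coeffs e L c \<longrightarrow>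
        (matrix_relation e V x L \<longleftrightarrow> c = f x)) \<and>
    (\<forall>G (g :: real ^ 'n \<Rightarrow> real ^ 'n).
        0 \<in> G \<and> (\<forall>i\<in>{1..CARD('n)}. real_analytic_on (\<lambda>x. g x $ e i) G) \<and>
        (\<forall>x\<in>G. \<exists>L. gl_regular L \<and> has_char_coeffs e L (g x) \<and> matrix_relation e V x L)
        \<longrightarrow> (\<forall>\<^sub>F x in nhds 0. g x = f x)) \<and>
    (\<forall>x\<in>U.
        (\<forall>i\<in>{1..<CARD('n)}. \<forall>j\<in>{1..<CARD('n)}.
           partial_deriv (e j) (\<lambda>y. f y $ e i) x =
             f x $ e i * partial_deriv (e (j + 1)) (\<lambda>y. f y $ e 1) x +
             partial_deriv (e (j + 1)) (\<lambda>y. f y $ e (i + 1)) x) \<and>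
        (\<forall>j\<in>{1..<CARD('n)}.
           partial_deriv (e j) (\<lambda>y. f y $ e CARD('n)) x =
             f x $ e CARD('n) * partial_deriv (e (j + 1)) (\<lambda>y. f y $ e 1) x)) \<and>
    (\<forall>t. t *\<^sub>R axis (e CARD('n)) 1 \<in> U \<longrightarrow>
        (\<forall>i\<in>{1..CARD('n)}. f (t *\<^sub>R axis (e CARD('n)) 1) $ e i = v i t))"
proof -
  let ?n = "CARD('n)"
  have n: "?n \<in> {1..?n}" by (simp add: Suc_le_eq)
  have rad: "fps_conv_radius (V i) > 0" if "i \<in> {1..?n}" for i
    using v_analytic[OF that] by (simp add: has_fps_expansion_def)
  have "\<forall>\<^sub>F t in nhds 0. \<forall>i\<in>{1..?n}. eval_fps (V i) t = v i t"
    using v_analytic by (intro eventually_ball_finite) (auto simp: has_fps_expansion_def)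
  \<comment> \<open>The v_i agree with their series only near 0; keeping \<epsilon> below \<delta>
    makes them agree along the whole axis segment inside \<open>U\<close>.\<close>
  then obtain \<delta> where \<delta>: "\<delta> > 0"
    "\<And>t i. \<bar>t\<bar> < \<delta> \<Longrightarrow> i \<in> {1..?n} \<Longrightarrow> eval_fps (V i) t = v i t"
    unfolding eventually_nhds_metric dist_real_def by auto
  obtain K \<epsilon> \<mu> where "weierstrass_family e V K \<epsilon> \<mu>" and \<epsilon>: "\<epsilon> < \<delta>"
    using weierstrass_family_exists[OF enum _ \<delta>(1), of V] rad by blast
  then interpret weierstrass_family e V K \<epsilon> \<mu> by simp
  define U where "U = {x :: real ^ 'n. \<forall>k. \<bar>x $ k\<bar> < \<epsilon>}"
  define \<nu> where "\<nu> c = (\<Sum>i=1..?n. \<bar>c $ e i\<bar> * K ^ (?n - i))" for c :: "real ^ 'n"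
  \<comment> \<open>\<nu> is the weighted norm of \<open>lowpoly c\<close>, at most K^n/2 on
    solutions.\<close>
  define W where "W = {c. \<nu> c < 2 / 3 * K ^ ?n}"
  have inU: "\<And>k. \<bar>x $ k\<bar> < \<epsilon>" if "x \<in> U" for x using that by (simp add: U_def)
  have pde: "partial_deriv (e j) (\<lambda>y. sol y $ e i) x =
      sol x $ e i * partial_deriv (e (j + 1)) (\<lambda>y. sol y $ e 1) x +
      (if i < ?n then partial_deriv (e (j + 1)) (\<lambda>y. sol y $ e (i + 1)) x else 0)"
    if x: "x \<in> U" and ij: "i \<in> {1..?n}" "j \<in> {1..<?n}" for x i j
  proof -
    obtain \<rho> where "\<rho> > 0" "\<And>k. \<bar>x $ k\<bar> + \<rho> \<le> \<epsilon>" using cube_radius[OF inU[OF x]] by blast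
    from sol_pde[OF this ij] show ?thesis .
  qed
  have openU: "open U"
    unfolding U_def Collect_all_eq
    by (intro open_INT ballI open_Collect_less continuous_intros) auto
  have zeroU: "0 \<in> U" using eps by (simp add: U_def)
  have openW: "open W"
    unfolding W_def \<nu>_def by (intro open_Collect_less continuous_intros)
  have image: "sol ` U \<subseteq> W"
  proof
    fix c assume "c \<in> sol ` U"
    then have "\<nu> c \<le> 1 / 2 * K ^ ?n" using sol_bound[OF inU] by (auto simp: \<nu>_def)
    also have "\<dots> < 2 / 3 * K ^ ?n" using K by simp
    finally show "c \<in> W" by (simp add: W_def)
  qed
  have analytic: "\<forall>i\<in>{1..?n}. real_analytic_on (\<lambda>x. sol x $ e i) U"
  proof (intro ballI real_analytic_onI[OF openU])
    fix i a assume i: "i \<in> {1..?n}" and a: "a \<in> U"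
    obtain \<rho> where "\<rho> > 0" "\<And>k. \<bar>a $ k\<bar> + \<rho> \<le> \<epsilon>" using cube_radius[OF inU[OF a]] by blast
    then show "\<exists>\<rho>>0. \<exists>c B. ps_expansion a \<rho> c B (\<lambda>x. sol x $ e i)"
      using sol_expansion[OF _ _ i] by blast
  qed
  have rel: "\<forall>x\<in>U. \<forall>c\<in>W. \<forall>L. gl_regular L \<and> has_char_coeffs e L c \<longrightarrow>
      (matrix_relation e V x L \<longleftrightarrow> c = sol x)"
    using matrix_relation_iff_sol[OF inU] by (simp add: W_def \<nu>_def)
  \<comment> \<open>The values of \<open>g\<close> are not assumed to lie in \<open>W\<close>. The
    relation forces g(0) = v(0), which lies there, and continuity keeps g(x) in \<open>W\<close> for
    x near 0, where \<open>rel\<close> applies.\<close>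
  have germ: "\<forall>\<^sub>F x in nhds 0. g x = sol x"
    if "0 \<in> G" and an: "\<forall>i\<in>{1..?n}. real_analytic_on (\<lambda>x. g x $ e i) G"
      and gL: "\<forall>x\<in>G. \<exists>L. gl_regular L \<and> has_char_coeffs e L (g x) \<and> matrix_relation e V x L"
    for G and g :: "real ^ 'n \<Rightarrow> real ^ 'n"
  proof -
    \<comment> \<open>Openness of the domain is part of \<open>real_analytic_on\<close>, so any one
      component provides it.\<close>
    have "open G" using bspec[OF an n] by (simp add: real_analytic_on_def)
    have "((\<lambda>x. g x $ e i) \<longlongrightarrow> g 0 $ e i) (nhds 0)" if "i \<in> {1..?n}" for i
      using real_analytic_on_ps_expansion[of "\<lambda>x. g x $ e i" G 0] an that \<open>0 \<in> G\<close> ps_expansion_tendsto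
      by blast
    then have "((\<lambda>x. \<nu> (g x)) \<longlongrightarrow> \<nu> (g 0)) (nhds 0)"
      unfolding \<nu>_def by (intro tendsto_sum tendsto_mult tendsto_rabs tendsto_const)
    moreover have "\<nu> (g 0) < 2 / 3 * K ^ ?n"
    proof -
      obtain L where L: "gl_regular L" "has_char_coeffs e L (g 0)" "matrix_relation e V 0 L"
        using gL \<open>0 \<in> G\<close> by blast
      have "\<nu> (g 0) = (\<Sum>i=1..?n. \<bar>fps_nth (V i) 0\<bar> * K ^ (?n - i))"
        unfolding \<nu>_def by (rule sum.cong) (simp_all add: matrix_relation_at_0[OF L])
      also have "\<dots> \<le> (\<Sum>i=1..?n. K ^ (?n - i) * (\<Sum>l. \<bar>fps_nth (V i) l\<bar> * \<mu> ^ l))"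
      proof (rule sum_mono)
        fix i assume i: "i \<in> {1..?n}"
        have "\<mu> \<ge> 0" unfolding mu using eps K by (intro mult_nonneg_nonneg sum_nonneg) auto
        then have "(\<Sum>l\<in>{0}. \<bar>fps_nth (V i) l\<bar> * \<mu> ^ l) \<le> (\<Sum>l. \<bar>fps_nth (V i) l\<bar> * \<mu> ^ l)"
          by (intro sum_le_suminf[OF conv[OF i]]) auto
        then show "\<bar>fps_nth (V i) 0\<bar> * K ^ (?n - i) \<le> K ^ (?n - i) * (\<Sum>l. \<bar>fps_nth (V i) l\<bar> * \<mu> ^ l)"
          using K by (simp add: mult.commute)
      qed
      also note small
      also have "1 / 3 * K ^ ?n < 2 / 3 * K ^ ?n" using K by simp
      finally show ?thesis .
    qed
    ultimately have "\<forall>\<^sub>F x in nhds 0. \<nu> (g x) < 2 / 3 * K ^ ?n" by (rule order_tendstoD(2))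
    moreover have "\<forall>\<^sub>F x in nhds 0. x \<in> U \<inter> G"
      using openU \<open>open G\<close> zeroU \<open>0 \<in> G\<close> by (intro eventually_nhds_in_open) auto
    ultimately show ?thesis
    proof eventually_elim
      case (elim x)
      then obtain L where "gl_regular L" "has_char_coeffs e L (g x)" "matrix_relation e V x L"
        using gL by blast
      with rel elim show ?case by (auto simp: W_def)
    qed
  qed
  have pdes: "\<forall>x\<in>U. (\<forall>i\<in>{1..<?n}. \<forall>j\<in>{1..<?n}.
      partial_deriv (e j) (\<lambda>y. sol y $ e i) x =
        sol x $ e i * partial_deriv (e (j + 1)) (\<lambda>y. sol y $ e 1) x +
        partial_deriv (e (j + 1)) (\<lambda>y. sol y $ e (i + 1)) x) \<and>
      (\<forall>j\<in>{1..<?n}. partial_deriv (e j) (\<lambda>y. sol y $ e ?n) x =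
        sol x $ e ?n * partial_deriv (e (j + 1)) (\<lambda>y. sol y $ e 1) x)"
    using pde[of _ ?n] pde n by auto
  have initial: "sol (t *\<^sub>R axis (e ?n) 1) $ e i = v i t"
    if t: "t *\<^sub>R axis (e ?n) 1 \<in> U" and i: "i \<in> {1..?n}" for t i
  proof -
    have "\<bar>t\<bar> < \<delta>" using inU[OF t, of "e ?n"] \<epsilon> by (simp add: axis_def)
    then show ?thesis
      using sol_initial[OF inU[OF t] i] \<delta>(2)[OF _ i] by (simp add: eval_fps_def)
  qed
  show ?thesis
    by (intro exI[of _ U] exI[of _ W] exI[of _ sol] conjI allI impI)
       (fact openU zeroU openW image analytic rel pdes
        | (elim conjE, rule germ; assumption) | (rule ballI, rule initial; assumption))+
qed

end
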